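(* Let $f$ be a continuous self-map of a compact metric space $(X,d)$ whose topological entropy is finite. Then there exists an affine and upper semi-continuous entropy map $\mathfrak{h}_1:\mathcal{P}_a(X)\to\mathbb{R}$ such that $$P(f,\Phi)=\max_{\mu\in\mathcal{P}_a(X)}\Big\{\mathfrak{h}_1(\mu)+\int\psi_\Phi\,d\mu\Big\}\qquad\forall\,\Phi\in\mathcal{S}_b.$$
   Context: $B_m(X)$ is the space of bounded Borel measurable functions $X\to\mathbb{R}$ with the supremum norm. $\mathcal{P}_a(X)$ is the set of finitely additive Borel probability measures on $X$ (identified with the positive normalized elements of the dual of $B_m(X)$), with the total variation norm $\|\mu-\nu\|=\sup\{|\int\psi\,d\mu-\int\psi\,d\nu|:\psi\in B_m(X),\|\psi\|_\infty\leqslant1\}$. $C(X)$ is the space of continuous functions $X\to\mathbb{R}$. A sequence $\Phi=(\varphi_n)_{n\in\mathbb{N}}\in C(X)^{\mathbb{N}}$ is sub-additive if $\varphi_{m+n}\leqslant\varphi_m+\varphi_n\circ f^m$ for all $m,n\in\mathbb{N}$. $\mathcal{S}_b$ is the set of sub-additive sequences $\Phi=(\varphi_n)_{n\in\mathbb{N}}\in C(X)^{\mathbb{N}}$ with $\inf_{x\in X}\big[\inf_{n\in\mathbb{N}}\frac1n\varphi_n(x)\big]>-\infty$. For $\Phi\in\mathcal{S}_b$, $\psi_\Phi(x)=\inf_{n\in\mathbb{N}}\frac1n\varphi_n(x)$, which belongs to $B_m(X)$. Let $d_n(x,z)=\max_{0\leqslant j\leqslant n}d(f^j(x),f^j(z))$;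 a set $E\subset X$ is $(n,\varepsilon)$-separated if $d_n(x,z)\geqslant\varepsilon$ for all distinct $x,z\in E$. With $s_n(f,\varepsilon)$ the maximal cardinality of the $(n,\varepsilon)$-separated subsets of $X$, the topological entropy of $f$ is $\lim_{\varepsilon\to0^+}\limsup_{n\to+\infty}\frac1n\log s_n(f,\varepsilon)$. The non-additive topological pressure is $P(f,\Phi)=\lim_{\varepsilon\to0^+}\limsup_{n\to+\infty}\frac1n\log\big(\sup_E\sum_{x\in E}e^{\varphi_n(x)}\big)$, the supremum being over the $(n,\varepsilon)$-separated subsets $E$ of $X$. *)

theory Defs
  imports "HOL-Analysis.Analysis"
begin

section \<open>Finitely additive Borel probability measures\<close>

definition Bm :: "('a::topological_space \<Rightarrow> real) set" where
  "Bm = {\<psi>. \<psi> \<in> borel_measurable borel \<and> bounded (range \<psi>)}"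

text \<open>Set functions are total in HOL; the value 0 outside the Borel sets makes the
  representation of a finitely additive measure unique.\<close>

definition Pa :: "('a::topological_space set \<Rightarrow> real) set" where
  "Pa = {\<mu>. (\<forall>A. A \<notin> sets borel \<longrightarrow> \<mu> A = 0)
           \<and> (\<forall>A\<in>sets borel. 0 \<le> \<mu> A)
           \<and> (\<forall>A\<in>sets borel. \<forall>B\<in>sets borel. A \<inter> B = {} \<longrightarrow> \<mu> (A \<union> B) = \<mu> A + \<mu> B)
           \<and> \<mu> UNIV = 1}"

text \<open>The integral of a bounded Borel function against a finitely additive measure. A bounded
  Borel function is a uniform limit of Borel simple functions, so for such an integrand the
  supremum over simple minorants is the usual integral, i.e. the value of the positive
  normalized functional on \<^const>\<open>Bm\<close> that corresponds to the measure. The library integrals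
  do not apply, since they need countable additivity.\<close>

definition simple_fa_integral ::
    "('a::topological_space set \<Rightarrow> real) \<Rightarrow> ('a \<Rightarrow> real) \<Rightarrow> real" where
  "simple_fa_integral \<mu> s = (\<Sum>y\<in>range s. y * \<mu> (s -` {y}))"

definition fa_integral ::
    "('a::topological_space set \<Rightarrow> real) \<Rightarrow> ('a \<Rightarrow> real) \<Rightarrow> real" where
  "fa_integral \<mu> \<psi> = Sup (simple_fa_integral \<mu> ` {s. simple_function borel s \<and> (\<forall>x. s x \<le> \<psi> x)})"

definition tv_dist ::
    "('a::topological_space set \<Rightarrow> real) \<Rightarrow> ('a set \<Rightarrow> real) \<Rightarrow> real" where
  "tv_dist \<mu> \<nu> = (SUP \<psi>\<in>{\<psi>\<in>Bm. \<forall>x. \<bar>\<psi> x\<bar> \<le> 1}. \<bar>fa_integral \<mu> \<psi> - fa_integral \<nu> \<psi>\<bar>)"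

definition affine_on_Pa :: "(('a::topological_space set \<Rightarrow> real) \<Rightarrow> real) \<Rightarrow> bool" where
  "affine_on_Pa h \<longleftrightarrow> (\<forall>\<mu>\<in>Pa. \<forall>\<nu>\<in>Pa. \<forall>t\<in>{0..1}.
     h (\<lambda>A. t * \<mu> A + (1 - t) * \<nu> A) = t * h \<mu> + (1 - t) * h \<nu>)"

definition usc_on_Pa :: "(('a::topological_space set \<Rightarrow> real) \<Rightarrow> real) \<Rightarrow> bool" where
  "usc_on_Pa h \<longleftrightarrow> (\<forall>\<mu>\<in>Pa. \<forall>e>0. \<exists>\<delta>>0. \<forall>\<nu>\<in>Pa. tv_dist \<nu> \<mu> < \<delta> \<longrightarrow> h \<nu> < h \<mu> + e)"

section \<open>Sub-additive sequences\<close>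

text \<open>Sequences are indexed by the positive integers; the entry at index 0 is never used.\<close>

definition subadditive_seq ::
    "('a::topological_space \<Rightarrow> 'a) \<Rightarrow> (nat \<Rightarrow> 'a \<Rightarrow> real) \<Rightarrow> bool" where
  "subadditive_seq f \<Phi> \<longleftrightarrow> (\<forall>n\<ge>1. continuous_on UNIV (\<Phi> n))
     \<and> (\<forall>m\<ge>1. \<forall>n\<ge>1. \<forall>x. \<Phi> (m + n) x \<le> \<Phi> m x + \<Phi> n ((f ^^ m) x))"

definition Sb :: "('a::topological_space \<Rightarrow> 'a) \<Rightarrow> (nat \<Rightarrow> 'a \<Rightarrow> real) set" where
  "Sb f = {\<Phi>. subadditive_seq f \<Phi> \<and> (INF x. INF n\<in>{1..}. ereal (\<Phi> n x / real n)) > -\<infinity>}"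

definition psi :: "(nat \<Rightarrow> 'a \<Rightarrow> real) \<Rightarrow> 'a \<Rightarrow> real" where
  "psi \<Phi> x = (INF n\<in>{1..}. \<Phi> n x / real n)"

section \<open>Topological entropy and non-additive pressure\<close>

definition bowen_dist :: "('a::metric_space \<Rightarrow> 'a) \<Rightarrow> nat \<Rightarrow> 'a \<Rightarrow> 'a \<Rightarrow> real" where
  "bowen_dist f n x z = (MAX j\<in>{0..n}. dist ((f ^^ j) x) ((f ^^ j) z))"

definition separated :: "('a::metric_space \<Rightarrow> 'a) \<Rightarrow> nat \<Rightarrow> real \<Rightarrow> 'a set \<Rightarrow> bool" where
  "separated f n \<epsilon> E \<longleftrightarrow> (\<forall>x\<in>E. \<forall>z\<in>E. x \<noteq> z \<longrightarrow> bowen_dist f n x z \<ge> \<epsilon>)"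

text \<open>For a continuous self-map of a compact space and \<open>\<epsilon> > 0\<close>, the cardinalities of
  the separated sets are bounded. Hence the sets are finite, and the maximum and the real
  supremum below are genuine. The limits as \<open>\<epsilon>\<close> decreases to 0 exist in \<^typ>\<open>ereal\<close>
  by monotonicity.\<close>

definition max_sep :: "('a::metric_space \<Rightarrow> 'a) \<Rightarrow> nat \<Rightarrow> real \<Rightarrow> nat" where
  "max_sep f n \<epsilon> = Max {card E |E. separated f n \<epsilon> E}"

definition topological_entropy :: "('a::metric_space \<Rightarrow> 'a) \<Rightarrow> ereal" where
  "topological_entropy f =
     Lim (at_right 0) (\<lambda>\<epsilon>. limsup (\<lambda>n. ereal (ln (real (max_sep f n \<epsilon>)) / real n)))"

definition pressure :: "('a::metric_space \<Rightarrow> 'a) \<Rightarrow> (nat \<Rightarrow> 'a \<Rightarrow> real) \<Rightarrow> ereal" where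
  "pressure f \<Phi> =
     Lim (at_right 0) (\<lambda>\<epsilon>. limsup (\<lambda>n.
       ereal (ln (SUP E\<in>{E. separated f n \<epsilon> E}. \<Sum>x\<in>E. exp (\<Phi> n x)) / real n)))"

end

theory Submission
  imports Defs
begin

text \<open>
  The entropy map is \<open>h\<^sub>1(\<mu>) = inf \<integral>\<phi> d\<mu>\<close>, where \<open>\<phi>\<close> ranges over the bounded Borel functions that
  dominate a minimum of finitely many of the functions \<open>P(f,\<Phi>) - \<psi>\<^sub>\<Phi>\<close>. An infimum of integrals
  is concave in \<open>\<mu>\<close>. Because this family is closed under pointwise minima, it is also convex:
  near-optimal functions for \<open>\<mu>\<close> and for \<open>\<nu>\<close> can be replaced by their minimum. So \<open>h\<^sub>1\<close> is affine,
  and it is upper semi-continuous as an infimum of continuous maps. Since \<open>P(f,\<Phi>) - \<psi>\<^sub>\<Phi>\<close> belongs to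
  the family, \<open>h\<^sub>1(\<mu>) + \<integral>\<psi>\<^sub>\<Phi> d\<mu> \<le> P(f,\<Phi>)\<close>.

  For the maximum, fix \<open>\<Phi>\<^sub>0\<close>. A measure attains it as soon as it gives mass 1 to each set
  \<open>{x. P(f,\<Phi>\<^sub>0) - \<psi>\<^sub>\<Phi>\<^sub>0(x) - \<epsilon> \<le> \<phi>(x)}\<close>. If these sets have the finite intersection property, an ultrafilter
  containing them is such a (two-valued, finitely additive) measure. What remains is a statement
  about points: for finitely many \<open>\<Phi>\<^sub>1,\<dots>,\<Phi>\<^sub>m\<close> and \<open>\<epsilon> > 0\<close> some \<open>x\<close> satisfies
  \<open>P(f,\<Phi>\<^sub>0) - \<psi>\<^sub>\<Phi>\<^sub>0(x) - \<epsilon> \<le> P(f,\<Phi>\<^sub>i) - \<psi>\<^sub>\<Phi>\<^sub>i(x)\<close> for all \<open>i\<close>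
  (lemma \<open>ex_point_nearly_dominating\<close>).

  This is proved by counting orbits, without invariant measures. Assume that no such \<open>x\<close> exists.
  Every \<open>x\<close> has a time \<open>k\<close> at which \<open>\<psi>\<^sub>\<Phi>\<^sub>0\<close> is almost maximal along the orbit of \<open>x\<close>, and there are then
  infinitely many \<open>n\<close> with \<open>\<phi>\<^sub>0\<^sub>n(x) < n (\<psi>\<^sub>\<Phi>\<^sub>0(f\<^sup>k x) + \<delta>)\<close> (lemma \<open>infinitely_often_near_psi\<close>). At \<open>f\<^sup>k x\<close> some
  \<open>\<Phi>\<^sub>i\<close> wins, and \<open>\<psi>\<^sub>\<Phi>\<^sub>i \<le> \<phi>\<^sub>i\<^sub>n / n\<close> for every \<open>n\<close>. So, up to the pressures, \<open>\<phi>\<^sub>0\<^sub>n(x)\<close> is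
  smaller than \<open>\<phi>\<^sub>i\<^sub>n(f\<^sup>k x)\<close> by a multiple of \<open>n\<close>, for arbitrarily large \<open>n\<close>. For fixed
  \<open>(k,i,n)\<close> this is an open condition, hence finitely many triples suffice for all \<open>x\<close>, with all \<open>n\<close>
  as large as desired. Each orbit is thereby cut into blocks, and on a block the partition sum of
  \<open>\<Phi>\<^sub>0\<close> is controlled by that of \<open>\<Phi>\<^sub>i\<close>, which grows at most like \<open>exp(n P(f,\<Phi>\<^sub>i))\<close>. A renewal inequality
  (lemma \<open>renewal_bound\<close>) turns this into a growth rate of the partition sums of \<open>\<Phi>\<^sub>0\<close> that is strictly
  smaller than \<open>P(f,\<Phi>\<^sub>0)\<close>, a contradiction.
\<close>

section \<open>Integration against finitely additive measures\<close>

lemma Pa_nonneg: "\<mu> \<in> Pa \<Longrightarrow> 0 \<le> \<mu> A"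
  by (cases "A \<in> sets borel") (auto simp: Pa_def)

lemma Pa_UNIV: "\<mu> \<in> Pa \<Longrightarrow> \<mu> UNIV = 1"
  by (simp add: Pa_def)

lemma Pa_Un: "\<mu> \<in> Pa \<Longrightarrow> A \<in> sets borel \<Longrightarrow> B \<in> sets borel \<Longrightarrow> A \<inter> B = {} \<Longrightarrow> \<mu> (A \<union> B) = \<mu> A + \<mu> B"
  unfolding Pa_def by blast

lemma Pa_empty: assumes "\<mu> \<in> Pa" shows "\<mu> {} = 0"
proof -
  have "\<mu> ({} \<union> {}) = \<mu> {} + \<mu> {}"
    using assms by (intro Pa_Un) auto
  then show ?thesis by simp
qed

lemma Pa_finite_UN:
  assumes "\<mu> \<in> Pa" "finite I" "\<And>i. i \<in> I \<Longrightarrow> B i \<in> sets borel" "disjoint_family_on B I"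
  shows "\<mu> (\<Union>i\<in>I. B i) = (\<Sum>i\<in>I. \<mu> (B i))"
  using assms(2,3,4)
proof (induction I rule: finite_induct)
  case empty
  then show ?case using Pa_empty[OF assms(1)] by simp
next
  case (insert i I)
  have "B i \<inter> (\<Union>j\<in>I. B j) = {}"
    using insert.hyps(2) insert.prems(2) by (auto simp: disjoint_family_on_def)
  moreover have "B i \<in> sets borel" "(\<Union>j\<in>I. B j) \<in> sets borel"
    using insert.hyps(1) insert.prems(1) by (simp_all add: sets.finite_UN)
  ultimately have "\<mu> (B i \<union> (\<Union>j\<in>I. B j)) = \<mu> (B i) + \<mu> (\<Union>j\<in>I. B j)"
    by (intro Pa_Un[OF assms(1)])
  then show ?case using insert by (simp add: disjoint_family_on_def)
qed

lemma Pa_compl: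
  assumes "\<mu> \<in> Pa" "A \<in> sets borel" shows "\<mu> (- A) = 1 - \<mu> A"
proof -
  have "\<mu> (A \<union> - A) = \<mu> A + \<mu> (- A)"
    using assms by (intro Pa_Un) auto
  then show ?thesis using Pa_UNIV[OF assms(1)] by simp
qed

lemma Pa_mono:
  assumes "\<mu> \<in> Pa" "A \<in> sets borel" "B \<in> sets borel" "A \<subseteq> B" shows "\<mu> A \<le> \<mu> B"
proof -
  have "A \<inter> (B - A) = {}" "B - A \<in> sets borel" using assms by auto
  then have "\<mu> (A \<union> (B - A)) = \<mu> A + \<mu> (B - A)"
    using assms(1,2) by (intro Pa_Un)
  moreover have "A \<union> (B - A) = B" using assms(4) by blast
  ultimately show ?thesis using Pa_nonneg[OF assms(1), of "B - A"] by simp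
qed

text \<open>
  A simple function may be integrated over any finite Borel partition on which it is constant.
  Taking the partition generated by two functions at once gives monotonicity below.
\<close>

lemma simple_fa_integral_comp:
  fixes r :: "'a::topological_space \<Rightarrow> 'b"
  assumes \<mu>: "\<mu> \<in> Pa" and fin: "finite (range r)" and mb: "\<And>z. r -` {z} \<in> sets borel"
  shows "simple_fa_integral \<mu> (\<lambda>x. g (r x)) = (\<Sum>z\<in>range r. g z * \<mu> (r -` {z}))"
proof -
  have "\<mu> ((\<lambda>x. g (r x)) -` {y}) = (\<Sum>z\<in>{z \<in> range r. g z = y}. \<mu> (r -` {z}))" for y
  proof -
    have "(\<lambda>x. g (r x)) -` {y} = (\<Union>z\<in>{z \<in> range r. g z = y}. r -` {z})" by auto
    then show ?thesis
      using Pa_finite_UN[OF \<mu>, of "{z \<in> range r. g z = y}" "\<lambda>z. r -` {z}"] fin mb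
      by (auto simp: disjoint_family_on_def)
  qed
  then have "simple_fa_integral \<mu> (\<lambda>x. g (r x))
      = (\<Sum>y\<in>g ` range r. \<Sum>z\<in>{z \<in> range r. g z = y}. g z * \<mu> (r -` {z}))"
    unfolding simple_fa_integral_def by (simp add: sum_distrib_left image_image)
  also have "\<dots> = (\<Sum>z\<in>range r. g z * \<mu> (r -` {z}))"
    using sum.image_gen[OF fin, of "\<lambda>z. g z * \<mu> (r -` {z})" g] by simp
  finally show ?thesis .
qed

lemma simple_borel_iff:
  "simple_function borel s \<longleftrightarrow> finite (range s) \<and> (\<forall>z. s -` {z} \<in> sets borel)"
proof -
  have "s -` {z} \<in> sets borel" if "\<forall>z\<in>range s. s -` {z} \<in> sets borel" for z
  proof (cases "z \<in> range s")
    case False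
    then have "s -` {z} = {}" by auto
    then show ?thesis by simp
  qed (use that in auto)
  then show ?thesis
    by (simp only: simple_function_def space_borel Int_UNIV_right) blast
qed

lemma simple_fa_integral_affine:
  assumes "\<mu> \<in> Pa" "simple_function borel s"
  shows "simple_fa_integral \<mu> (\<lambda>x. a * s x + b) = a * simple_fa_integral \<mu> s + b"
proof -
  have s: "finite (range s)" "\<And>z. s -` {z} \<in> sets borel"
    using assms(2) unfolding simple_borel_iff by blast+
  have "(\<Sum>z\<in>range s. \<mu> (s -` {z})) = simple_fa_integral \<mu> (\<lambda>x. 1)"
    using simple_fa_integral_comp[OF assms(1) s, of "\<lambda>_. 1"] by simp
  also have "\<dots> = 1"
    using Pa_UNIV[OF assms(1)] by (simp add: simple_fa_integral_def)
  finally have 1: "(\<Sum>z\<in>range s. \<mu> (s -` {z})) = 1" .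
  have "simple_fa_integral \<mu> (\<lambda>x. a * s x + b) = (\<Sum>z\<in>range s. (a * z + b) * \<mu> (s -` {z}))"
    by (rule simple_fa_integral_comp[OF assms(1) s, of "\<lambda>z. a * z + b"])
  also have "\<dots> = a * (\<Sum>z\<in>range s. z * \<mu> (s -` {z})) + b * (\<Sum>z\<in>range s. \<mu> (s -` {z}))"
    by (simp add: algebra_simps sum.distrib sum_distrib_left)
  finally show ?thesis using 1 by (simp add: simple_fa_integral_def)
qed

text \<open>
  The set \<open>G\<close> plays the role of an almost sure event; it is needed because the maximizing
  measures are only known through the sets to which they give mass 1.
\<close>

lemma simple_fa_integral_mono:
  assumes \<mu>: "\<mu> \<in> Pa" and s: "simple_function borel s" and t: "simple_function borel t"
    and G: "G \<in> sets borel" "\<mu> G = 1" and le: "\<And>x. x \<in> G \<Longrightarrow> s x \<le> t x"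
  shows "simple_fa_integral \<mu> s \<le> simple_fa_integral \<mu> t"
proof -
  define r where "r x = (s x, t x, x \<in> G)" for x
  have "range r \<subseteq> range s \<times> range t \<times> UNIV" by (auto simp: r_def)
  then have fin: "finite (range r)"
  proof (rule finite_subset)
    show "finite (range s \<times> range t \<times> (UNIV :: bool set))"
      using s t unfolding simple_borel_iff by (intro finite_cartesian_product) auto
  qed
  have mb: "r -` {z} \<in> sets borel" for z
  proof -
    obtain a b c where z: "z = (a, b, c)" by (cases z) auto
    have "r -` {z} = s -` {a} \<inter> t -` {b} \<inter> (if c then G else - G)"
      by (auto simp: r_def z)
    then show ?thesis using s t G by (auto simp: simple_borel_iff)
  qed
  have "simple_fa_integral \<mu> s = (\<Sum>z\<in>range r. fst z * \<mu> (r -` {z}))"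
    using simple_fa_integral_comp[OF \<mu> fin mb, of fst] by (simp add: r_def)
  also have "\<dots> \<le> (\<Sum>z\<in>range r. fst (snd z) * \<mu> (r -` {z}))"
  proof (rule sum_mono)
    fix z assume "z \<in> range r"
    then obtain x where x: "z = (s x, t x, x \<in> G)" by (auto simp: r_def)
    show "fst z * \<mu> (r -` {z}) \<le> fst (snd z) * \<mu> (r -` {z})"
    proof (cases "x \<in> G")
      case True
      then show ?thesis using le x Pa_nonneg[OF \<mu>] by (auto intro: mult_right_mono)
    next
      case False
      then have "r -` {z} \<subseteq> - G" using x by (auto simp: r_def)
      then have "\<mu> (r -` {z}) \<le> 1 - \<mu> G"
        using Pa_mono[OF \<mu> mb[of z], of "- G"] Pa_compl[OF \<mu> G(1)] G by auto
      then have "\<mu> (r -` {z}) = 0" using G Pa_nonneg[OF \<mu>, of "r -` {z}"] by simp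
      then show ?thesis by simp
    qed
  qed
  also have "\<dots> = simple_fa_integral \<mu> t"
    using simple_fa_integral_comp[OF \<mu> fin mb, of "\<lambda>z. fst (snd z)"] by (simp add: r_def)
  finally show ?thesis .
qed

lemma simple_affine:
  "simple_function borel s \<Longrightarrow> simple_function borel (\<lambda>x. a * s x + (b::real))"
  using simple_function_compose1[of borel s "\<lambda>z. a * z + b"] by simp

text \<open>
  All further properties of the integral come from simple functions by this estimate: the same
  uniform approximation serves every measure.
\<close>

lemma fa_integral_approx:
  assumes \<mu>: "\<mu> \<in> Pa" and s: "simple_function borel s" and e: "\<And>x. \<bar>\<psi> x - s x\<bar> \<le> e"
  shows "\<bar>fa_integral \<mu> \<psi> - simple_fa_integral \<mu> s\<bar> \<le> e"
proof -
  have G: "UNIV \<in> sets borel" "\<mu> UNIV = 1" using Pa_UNIV[OF \<mu>] by auto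
  let ?M = "simple_fa_integral \<mu> ` {s. simple_function borel s \<and> (\<forall>x. s x \<le> \<psi> x)}"
  have sh: "simple_fa_integral \<mu> (\<lambda>x. s x + c) = simple_fa_integral \<mu> s + c"
    "simple_function borel (\<lambda>x. s x + c)" for c
    using simple_fa_integral_affine[OF \<mu> s, of 1 c] simple_affine[OF s, of 1 c] by auto
  have up: "y \<le> simple_fa_integral \<mu> s + e" if y: "y \<in> ?M" for y
  proof -
    obtain t where yt: "y = simple_fa_integral \<mu> t"
      and "t \<in> {s. simple_function borel s \<and> (\<forall>x. s x \<le> \<psi> x)}"
      by (rule imageE[OF y])
    then have t: "simple_function borel t" "\<And>x. t x \<le> \<psi> x" by simp_all
    have "t x \<le> s x + e" for x using t(2)[of x] e[of x] by linarith
    then show ?thesis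
      using simple_fa_integral_mono[OF \<mu> t(1) sh(2)[of e] G] sh(1)[of e] yt by auto
  qed
  have lo: "simple_fa_integral \<mu> s - e \<in> ?M"
  proof
    show "simple_fa_integral \<mu> s - e = simple_fa_integral \<mu> (\<lambda>x. s x + - e)" using sh(1)[of "-e"] by simp
    have "s x + - e \<le> \<psi> x" for x using e[of x] by linarith
    then show "(\<lambda>x. s x + - e) \<in> {s. simple_function borel s \<and> (\<forall>x. s x \<le> \<psi> x)}"
      using sh(2)[of "- e"] by (simp only: mem_Collect_eq) blast
  qed
  have "fa_integral \<mu> \<psi> \<le> simple_fa_integral \<mu> s + e"
    unfolding fa_integral_def by (rule cSup_least) (use lo up in auto)
  moreover have "simple_fa_integral \<mu> s - e \<le> fa_integral \<mu> \<psi>"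
    unfolding fa_integral_def by (rule cSup_upper[OF lo]) (use up in \<open>auto intro!: bdd_aboveI\<close>)
  ultimately show ?thesis by linarith
qed

lemma Bm_uniform_approx:
  assumes "\<psi> \<in> Bm" "e > 0"
  shows "\<exists>s. simple_function borel s \<and> (\<forall>x. \<bar>\<psi> x - s x\<bar> \<le> e)"
proof (intro exI conjI allI)
  let ?s = "\<lambda>x. e * real_of_int \<lfloor>\<psi> x / e\<rfloor>"
  obtain C where C: "\<And>x. \<bar>\<psi> x\<bar> \<le> C" using assms(1) by (auto simp: Bm_def bounded_iff)
  have meas: "\<psi> \<in> borel_measurable borel" using assms(1) by (simp add: Bm_def)
  show "\<bar>\<psi> x - ?s x\<bar> \<le> e" for x
  proof -
    have "\<psi> x = e * (\<psi> x / e)" using assms(2) by simp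
    moreover have "e * of_int \<lfloor>\<psi> x / e\<rfloor> \<le> e * (\<psi> x / e)" "e * (\<psi> x / e) \<le> e * (of_int \<lfloor>\<psi> x / e\<rfloor> + 1)"
      using assms(2) by (intro mult_left_mono; linarith)+
    ultimately show ?thesis by (simp add: algebra_simps abs_le_iff)
  qed
  have "- C / e \<le> \<psi> x / e" "\<psi> x / e \<le> C / e" for x
    using C[of x] assms(2) by (intro divide_right_mono; linarith)+
  then have "\<lfloor>\<psi> x / e\<rfloor> \<in> {\<lfloor>- C / e\<rfloor>..\<lfloor>C / e\<rfloor>}" for x
    unfolding atLeastAtMost_iff by (blast intro: floor_mono)
  then have "range ?s \<subseteq> (\<lambda>k. e * real_of_int k) ` {\<lfloor>- C / e\<rfloor>..\<lfloor>C / e\<rfloor>}" by blast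
  then have "finite (range ?s)" by (rule finite_subset) auto
  moreover have "?s \<in> borel_measurable borel" using meas by measurable
  ultimately show "simple_function borel ?s"
    by (intro simple_function_borel_measurable) auto
qed

lemma Bm_affine: "\<psi> \<in> Bm \<Longrightarrow> (\<lambda>x. a * \<psi> x + b) \<in> Bm"
proof -
  assume p: "\<psi> \<in> Bm"
  then obtain C where C: "\<And>x. \<bar>\<psi> x\<bar> \<le> C" by (auto simp: Bm_def bounded_iff)
  have "\<bar>a * \<psi> x + b\<bar> \<le> \<bar>a\<bar> * C + \<bar>b\<bar>" for x
    using mult_left_mono[OF C[of x], of "\<bar>a\<bar>"] by (simp add: abs_mult[symmetric])
  then have "bounded (range (\<lambda>x. a * \<psi> x + b))" by (auto simp: bounded_iff)
  then show ?thesis using p by (auto simp: Bm_def)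
qed

lemma Bm_min: "\<phi> \<in> Bm \<Longrightarrow> \<psi> \<in> Bm \<Longrightarrow> (\<lambda>x. min (\<phi> x) (\<psi> x)) \<in> Bm"
proof -
  assume p: "\<phi> \<in> Bm" "\<psi> \<in> Bm"
  then obtain C D where "\<And>x. \<bar>\<phi> x\<bar> \<le> C" "\<And>x. \<bar>\<psi> x\<bar> \<le> D" by (auto simp: Bm_def bounded_iff)
  then have "\<bar>min (\<phi> x) (\<psi> x)\<bar> \<le> max C D" for x
    by (smt (verit, best))
  then have "bounded (range (\<lambda>x. min (\<phi> x) (\<psi> x)))" by (auto simp: bounded_iff)
  then show ?thesis using p by (auto simp: Bm_def)
qed

lemma fa_integral_affine:
  assumes \<mu>: "\<mu> \<in> Pa" and \<psi>: "\<psi> \<in> Bm"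
  shows "fa_integral \<mu> (\<lambda>x. a * \<psi> x + b) = a * fa_integral \<mu> \<psi> + b"
proof -
  have "\<bar>fa_integral \<mu> (\<lambda>x. a * \<psi> x + b) - (a * fa_integral \<mu> \<psi> + b)\<bar> \<le> e" if "e > 0" for e
  proof -
    define d where "d = e / (2 * \<bar>a\<bar> + 1)"
    have d: "d > 0" using that by (simp add: d_def add_nonneg_pos)
    have de: "2 * \<bar>a\<bar> * d \<le> e"
      using that by (simp add: d_def field_simps)
    obtain s where s: "simple_function borel s" "\<And>x. \<bar>\<psi> x - s x\<bar> \<le> d"
      using Bm_uniform_approx[OF \<psi> d] by blast
    have "\<bar>(a * \<psi> x + b) - (a * s x + b)\<bar> \<le> \<bar>a\<bar> * d" for x
      using mult_left_mono[OF s(2)[of x], of "\<bar>a\<bar>"] by (simp add: abs_mult[symmetric] right_diff_distrib)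
    then have 1: "\<bar>fa_integral \<mu> (\<lambda>x. a * \<psi> x + b) - (a * simple_fa_integral \<mu> s + b)\<bar> \<le> \<bar>a\<bar> * d"
      using fa_integral_approx[OF \<mu> simple_affine[OF s(1)], of "\<lambda>x. a * \<psi> x + b"]
        simple_fa_integral_affine[OF \<mu> s(1)] by metis
    have "\<bar>a * fa_integral \<mu> \<psi> - a * simple_fa_integral \<mu> s\<bar> \<le> \<bar>a\<bar> * d"
      using mult_left_mono[OF fa_integral_approx[OF \<mu> s], of "\<bar>a\<bar>"]
      by (simp add: abs_mult[symmetric] right_diff_distrib)
    with 1 de show ?thesis by linarith
  qed
  then have "\<bar>fa_integral \<mu> (\<lambda>x. a * \<psi> x + b) - (a * fa_integral \<mu> \<psi> + b)\<bar> \<le> 0"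
    by (rule field_le_epsilon) (simp only: add_0_left)
  then show ?thesis by simp
qed

lemma fa_integral_mono_ae:
  assumes \<mu>: "\<mu> \<in> Pa" and "\<phi> \<in> Bm" "\<psi> \<in> Bm"
    and G: "G \<in> sets borel" "\<mu> G = 1" and le: "\<And>x. x \<in> G \<Longrightarrow> \<phi> x \<le> \<psi> x"
  shows "fa_integral \<mu> \<phi> \<le> fa_integral \<mu> \<psi>"
proof (rule field_le_epsilon)
  fix e :: real assume "e > 0"
  then have d: "e / 4 > 0" by simp
  obtain s where s: "simple_function borel s" "\<And>x. \<bar>\<phi> x - s x\<bar> \<le> e / 4"
    using Bm_uniform_approx[OF assms(2) d] by blast
  obtain t where t: "simple_function borel t" "\<And>x. \<bar>\<psi> x - t x\<bar> \<le> e / 4"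
    using Bm_uniform_approx[OF assms(3) d] by blast
  have "s x \<le> 1 * t x + e / 2" if "x \<in> G" for x
    using s(2)[of x] t(2)[of x] le[OF that] by linarith
  then have "simple_fa_integral \<mu> s \<le> simple_fa_integral \<mu> t + e / 2"
    using simple_fa_integral_mono[OF \<mu> s(1) simple_affine[OF t(1)] G, of 1 "e / 2"]
      simple_fa_integral_affine[OF \<mu> t(1), of 1 "e / 2"] by simp
  then show "fa_integral \<mu> \<phi> \<le> fa_integral \<mu> \<psi> + e"
    using fa_integral_approx[OF \<mu> s] fa_integral_approx[OF \<mu> t] by linarith
qed

lemma fa_integral_mono:
  assumes "\<mu> \<in> Pa" "\<phi> \<in> Bm" "\<psi> \<in> Bm" "\<And>x. \<phi> x \<le> \<psi> x"
  shows "fa_integral \<mu> \<phi> \<le> fa_integral \<mu> \<psi>"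
  by (rule fa_integral_mono_ae[OF assms(1-3) _ Pa_UNIV[OF assms(1)] assms(4)]) simp

lemma Bm_const: "(\<lambda>x. c) \<in> Bm"
  by (simp add: Bm_def)

lemma fa_integral_const: "\<mu> \<in> Pa \<Longrightarrow> fa_integral \<mu> (\<lambda>x. c) = c"
  using fa_integral_affine[OF _ Bm_const, of \<mu> 0 0 c] by simp

lemma Pa_convex:
  assumes "\<mu> \<in> Pa" "\<nu> \<in> Pa" "t \<in> {0..1}"
  shows "(\<lambda>A. t * \<mu> A + (1 - t) * \<nu> A) \<in> Pa"
proof -
  have "t * (\<mu> A + \<mu> B) + (1 - t) * (\<nu> A + \<nu> B) = (t * \<mu> A + (1 - t) * \<nu> A) + (t * \<mu> B + (1 - t) * \<nu> B)" for A B
    by (simp add: algebra_simps)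
  moreover have "t * \<mu> A + (1 - t) * \<nu> A \<ge> 0" for A
    using Pa_nonneg[OF assms(1), of A] Pa_nonneg[OF assms(2), of A] assms(3) by simp
  ultimately show ?thesis
    using assms(1,2) unfolding Pa_def by simp
qed

lemma fa_integral_convex:
  assumes "\<mu> \<in> Pa" "\<nu> \<in> Pa" "t \<in> {0..1}" "\<psi> \<in> Bm"
  shows "fa_integral (\<lambda>A. t * \<mu> A + (1 - t) * \<nu> A) \<psi>
    = t * fa_integral \<mu> \<psi> + (1 - t) * fa_integral \<nu> \<psi>"
proof -
  let ?\<rho> = "\<lambda>A. t * \<mu> A + (1 - t) * \<nu> A"
  let ?d = "fa_integral ?\<rho> \<psi> - (t * fa_integral \<mu> \<psi> + (1 - t) * fa_integral \<nu> \<psi>)"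
  have "\<bar>?d\<bar> \<le> e" if "e > 0" for e
  proof -
    have d: "e / 2 > 0" using that by simp
    obtain s where s: "simple_function borel s" "\<And>x. \<bar>\<psi> x - s x\<bar> \<le> e / 2"
      using Bm_uniform_approx[OF assms(4) d] by blast
    have lin: "simple_fa_integral ?\<rho> s = t * simple_fa_integral \<mu> s + (1 - t) * simple_fa_integral \<nu> s"
      by (simp add: simple_fa_integral_def sum_distrib_left sum.distrib[symmetric] algebra_simps)
    have "\<bar>t * (fa_integral \<mu> \<psi> - simple_fa_integral \<mu> s)\<bar> \<le> t * (e / 2)"
      "\<bar>(1 - t) * (fa_integral \<nu> \<psi> - simple_fa_integral \<nu> s)\<bar> \<le> (1 - t) * (e / 2)"
      using mult_left_mono[OF fa_integral_approx[OF assms(1) s], of t]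
        mult_left_mono[OF fa_integral_approx[OF assms(2) s], of "1 - t"] assms(3)
      by (simp_all add: abs_mult)
    moreover have "t * (e / 2) + (1 - t) * (e / 2) = e / 2"
      by (simp add: diff_divide_distrib left_diff_distrib)
    ultimately show ?thesis
      using fa_integral_approx[OF Pa_convex[OF assms(1-3)] s]
      unfolding lin right_diff_distrib by linarith
  qed
  then have "\<bar>?d\<bar> \<le> 0"
    by (rule field_le_epsilon) (simp only: add_0_left)
  then show ?thesis by simp
qed

lemma fa_integral_tv_le:
  fixes \<psi> :: "'a::topological_space \<Rightarrow> real"
  assumes \<mu>: "\<mu> \<in> Pa" and \<nu>: "\<nu> \<in> Pa" and \<psi>: "\<psi> \<in> Bm" and C: "\<And>x. \<bar>\<psi> x\<bar> \<le> C" "C > 0"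
  shows "fa_integral \<nu> \<psi> \<le> fa_integral \<mu> \<psi> + C * tv_dist \<nu> \<mu>"
proof -
  let ?B = "{\<psi>::'a \<Rightarrow> real. \<psi> \<in> Bm \<and> (\<forall>x. \<bar>\<psi> x\<bar> \<le> 1)}"
  have b: "\<bar>fa_integral \<rho> \<phi>\<bar> \<le> 1" if "\<rho> \<in> Pa" "\<phi> \<in> ?B" for \<rho> and \<phi> :: "'a \<Rightarrow> real"
    using fa_integral_mono[OF that(1) _ Bm_const, of \<phi> 1] fa_integral_mono[OF that(1) Bm_const, of \<phi> "-1"]
      fa_integral_const[OF that(1)] that(2) by (auto simp: abs_le_iff minus_le_iff)
  have "bdd_above ((\<lambda>\<phi>. \<bar>fa_integral \<nu> \<phi> - fa_integral \<mu> \<phi>\<bar>) ` ?B)"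
  proof (rule bdd_aboveI2)
    fix \<phi> assume "\<phi> \<in> ?B"
    then show "\<bar>fa_integral \<nu> \<phi> - fa_integral \<mu> \<phi>\<bar> \<le> 2" using b[OF \<mu>, of \<phi>] b[OF \<nu>, of \<phi>] by linarith
  qed
  moreover have "(\<lambda>x. (1 / C) * \<psi> x + 0) \<in> ?B"
    using Bm_affine[OF \<psi>, of "1 / C" 0] C by (simp add: abs_mult divide_le_eq)
  ultimately have "\<bar>fa_integral \<nu> (\<lambda>x. (1 / C) * \<psi> x + 0) - fa_integral \<mu> (\<lambda>x. (1 / C) * \<psi> x + 0)\<bar> \<le> tv_dist \<nu> \<mu>"
    unfolding tv_dist_def by (rule cSUP_upper2) auto
  then have "(1 / C) * fa_integral \<nu> \<psi> - (1 / C) * fa_integral \<mu> \<psi> \<le> tv_dist \<nu> \<mu>"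
    by (simp only: fa_integral_affine[OF \<mu> \<psi>] fa_integral_affine[OF \<nu> \<psi>])
  then show ?thesis using C(2) by (simp add: field_simps)
qed

text \<open>
  Extend the family to a maximal family \<open>U\<close> with the finite intersection property. This is an
  ultrafilter, and the indicator of membership in \<open>U\<close> is additive on disjoint sets.
\<close>

lemma ex_two_valued_Pa:
  fixes \<B> :: "'a::topological_space set set"
  assumes fip: "\<And>F. finite F \<Longrightarrow> F \<subseteq> \<B> \<Longrightarrow> \<Inter>F \<noteq> {}"
  obtains \<mu> where "\<mu> \<in> Pa" "\<And>B. B \<in> \<B> \<Longrightarrow> B \<in> sets borel \<Longrightarrow> \<mu> B = 1"
proof -
  let ?FIP = "{U. \<B> \<subseteq> U \<and> (\<forall>F. finite F \<longrightarrow> F \<subseteq> U \<longrightarrow> \<Inter>F \<noteq> {})}"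
  have "\<exists>U\<in>?FIP. \<forall>V\<in>?FIP. U \<subseteq> V \<longrightarrow> V = U"
  proof (rule subset_Zorn_nonempty)
    have "\<B> \<in> ?FIP" using fip by simp
    then show "?FIP \<noteq> {}" by (metis empty_iff)
    fix \<C> assume ne: "\<C> \<noteq> {}" and ch: "subset.chain ?FIP \<C>"
    have "\<Inter>F \<noteq> {}" if F: "finite F" "F \<subseteq> \<Union>\<C>" for F
    proof -
      obtain U where "U \<in> \<C>" "F \<subseteq> U"
        by (rule finite_subset_Union_chain[OF F ne ch])
      then show ?thesis using ch F(1) unfolding subset.chain_def by blast
    qed
    then show "\<Union>\<C> \<in> ?FIP" using ne ch unfolding subset.chain_def by blast
  qed
  then obtain U where U: "\<B> \<subseteq> U" "\<And>F. finite F \<Longrightarrow> F \<subseteq> U \<Longrightarrow> \<Inter>F \<noteq> {}"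
    and mx: "\<And>V. \<B> \<subseteq> V \<Longrightarrow> (\<And>F. finite F \<Longrightarrow> F \<subseteq> V \<Longrightarrow> \<Inter>F \<noteq> {}) \<Longrightarrow> U \<subseteq> V \<Longrightarrow> V = U"
    by auto
  have memI: "A \<in> U" if A: "\<forall>F. finite F \<longrightarrow> F \<subseteq> U \<longrightarrow> A \<inter> \<Inter>F \<noteq> {}" for A
  proof -
    have fipA: "\<Inter>F \<noteq> {}" if F: "finite F" "F \<subseteq> insert A U" for F
    proof -
      have "finite (F - {A})" "F - {A} \<subseteq> U" using F by auto
      then have "A \<inter> \<Inter>(F - {A}) \<noteq> {}" by (rule A[rule_format])
      then obtain z where "z \<in> A" "z \<in> \<Inter>(F - {A})" by auto
      then have "z \<in> \<Inter>F" by (metis DiffI InterE InterI singletonD)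
      then show ?thesis by auto
    qed
    have sub: "\<B> \<subseteq> insert A U" "U \<subseteq> insert A U" using U(1) by auto
    have "insert A U = U" by (rule mx[OF sub(1) fipA sub(2)])
    then show ?thesis by blast
  qed
  have not2: "\<not> (A \<in> U \<and> B \<in> U)" if "A \<inter> B = {}" for A B
    using U(2)[of "{A, B}"] that by auto
  have un: "A \<in> U \<or> B \<in> U" if "A \<union> B \<in> U" for A B
  proof (rule ccontr)
    assume n: "\<not> ?thesis"
    obtain F where F: "finite F" "F \<subseteq> U" "A \<inter> \<Inter>F = {}" using memI[of A] n by auto
    obtain G where G: "finite G" "G \<subseteq> U" "B \<inter> \<Inter>G = {}" using memI[of B] n by auto
    have "\<Inter>(insert (A \<union> B) (F \<union> G)) = {}" using F(3) G(3) by auto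
    then show False using U(2)[of "insert (A \<union> B) (F \<union> G)"] F(1,2) G(1,2) that by auto
  qed
  have up: "B \<in> U" if "A \<in> U" "A \<subseteq> B" for A B
  proof (intro memI allI impI)
    fix F assume "finite F" "F \<subseteq> U"
    then show "B \<inter> \<Inter>F \<noteq> {}" using U(2)[of "insert A F"] that by auto
  qed
  have univ: "UNIV \<in> U" using U(2) by (intro memI allI impI) simp
  define \<mu> where "\<mu> A = (if A \<in> sets borel \<and> A \<in> U then 1 else 0 :: real)" for A
  have "\<mu> (A \<union> B) = \<mu> A + \<mu> B" if "A \<in> sets borel" "B \<in> sets borel" "A \<inter> B = {}" for A B
    using that un[of A B] not2[of A B] up[of A "A \<union> B"] up[of B "A \<union> B"] by (auto simp: \<mu>_def)
  moreover have "\<mu> A = 0" if "A \<notin> sets borel" for A using that by (simp add: \<mu>_def)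
  moreover have "0 \<le> \<mu> A" for A by (simp add: \<mu>_def)
  moreover have "\<mu> UNIV = 1" using univ by (simp add: \<mu>_def)
  ultimately have "\<mu> \<in> Pa" unfolding Pa_def by blast
  moreover have "\<mu> B = 1" if "B \<in> \<B>" "B \<in> sets borel" for B using that U(1) by (auto simp: \<mu>_def)
  ultimately show ?thesis using that by blast
qed

section \<open>Lower envelopes of families closed under minima\<close>

definition lower_envelope :: "('a::topological_space \<Rightarrow> real) set \<Rightarrow> ('a set \<Rightarrow> real) \<Rightarrow> real" where
  "lower_envelope \<A> \<mu> = (INF \<phi>\<in>\<A>. fa_integral \<mu> \<phi>)"

text \<open>
  The entropy map is the lower envelope of such a family. Closure under minima makes it affine, and
  the lower bound makes the infimum finite.
\<close>

locale min_closed_family =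
  fixes \<A> :: "('a::topological_space \<Rightarrow> real) set" and b :: real
  assumes nonempty: "\<A> \<noteq> {}"
    and Bm: "\<A> \<subseteq> Bm"
    and bounded_below: "\<And>\<phi> x. \<phi> \<in> \<A> \<Longrightarrow> b \<le> \<phi> x"
    and min_closed: "\<And>\<phi> \<psi>. \<phi> \<in> \<A> \<Longrightarrow> \<psi> \<in> \<A> \<Longrightarrow> (\<lambda>x. min (\<phi> x) (\<psi> x)) \<in> \<A>"
begin

lemma lower_envelope_le:
  assumes "\<mu> \<in> Pa" "\<phi> \<in> \<A>"
  shows "lower_envelope \<A> \<mu> \<le> fa_integral \<mu> \<phi>"
proof -
  have "b \<le> fa_integral \<mu> \<phi>" if "\<phi> \<in> \<A>" for \<phi>
    using fa_integral_mono[OF assms(1) Bm_const, of \<phi> b] Bm that bounded_below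
      fa_integral_const[OF assms(1), of b] by auto
  then show ?thesis unfolding lower_envelope_def using assms(2)
    by (intro cINF_lower) (auto intro!: bdd_belowI2)
qed

lemma lower_envelope_greatest:
  assumes "\<And>\<phi>. \<phi> \<in> \<A> \<Longrightarrow> c \<le> fa_integral \<mu> \<phi>"
  shows "c \<le> lower_envelope \<A> \<mu>"
  unfolding lower_envelope_def using nonempty assms by (intro cINF_greatest) auto

lemma lower_envelope_approx:
  assumes "e > 0"
  shows "\<exists>\<phi>\<in>\<A>. fa_integral \<mu> \<phi> < lower_envelope \<A> \<mu> + e"
proof (rule ccontr)
  assume "\<not> ?thesis"
  then have "lower_envelope \<A> \<mu> + e \<le> fa_integral \<mu> \<phi>" if "\<phi> \<in> \<A>" for \<phi>
    using that by (meson not_le)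
  then have "lower_envelope \<A> \<mu> + e \<le> lower_envelope \<A> \<mu>" by (rule lower_envelope_greatest)
  then show False using assms by simp
qed

text \<open>
  Concavity holds for any infimum of affine maps. For convexity, near-optimal functions for the two
  measures are replaced by their minimum, which is near-optimal for both.
\<close>

lemma lower_envelope_affine: "affine_on_Pa (lower_envelope \<A>)"
  unfolding affine_on_Pa_def
proof (intro ballI antisym)
  fix \<mu> \<nu> :: "'a set \<Rightarrow> real" and t :: real
  assume \<mu>: "\<mu> \<in> Pa" and \<nu>: "\<nu> \<in> Pa" and t: "t \<in> {0..1}"
  let ?\<rho> = "\<lambda>A. t * \<mu> A + (1 - t) * \<nu> A"
  show "t * lower_envelope \<A> \<mu> + (1 - t) * lower_envelope \<A> \<nu> \<le> lower_envelope \<A> ?\<rho>"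
  proof (rule lower_envelope_greatest)
    fix \<phi> assume \<phi>: "\<phi> \<in> \<A>"
    then have "fa_integral ?\<rho> \<phi> = t * fa_integral \<mu> \<phi> + (1 - t) * fa_integral \<nu> \<phi>"
      using Bm by (intro fa_integral_convex \<mu> \<nu> t) auto
    then show "t * lower_envelope \<A> \<mu> + (1 - t) * lower_envelope \<A> \<nu> \<le> fa_integral ?\<rho> \<phi>"
      using t lower_envelope_le[OF \<mu> \<phi>] lower_envelope_le[OF \<nu> \<phi>]
      by (auto intro!: add_mono mult_left_mono)
  qed
  show "lower_envelope \<A> ?\<rho> \<le> t * lower_envelope \<A> \<mu> + (1 - t) * lower_envelope \<A> \<nu>"
  proof (rule field_le_epsilon)
    fix e :: real assume e: "e > 0"
    obtain \<phi> where \<phi>: "\<phi> \<in> \<A>" "fa_integral \<mu> \<phi> < lower_envelope \<A> \<mu> + e"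
      using lower_envelope_approx[OF e] by blast
    obtain \<psi> where \<psi>: "\<psi> \<in> \<A>" "fa_integral \<nu> \<psi> < lower_envelope \<A> \<nu> + e"
      using lower_envelope_approx[OF e] by blast
    define \<kappa> where "\<kappa> x = min (\<phi> x) (\<psi> x)" for x
    have \<kappa>: "\<kappa> \<in> \<A>" unfolding \<kappa>_def[abs_def] by (rule min_closed[OF \<phi>(1) \<psi>(1)])
    have inB: "\<phi> \<in> Bm" "\<psi> \<in> Bm" "\<kappa> \<in> Bm" using Bm \<phi>(1) \<psi>(1) \<kappa> by auto
    have "fa_integral \<mu> \<kappa> \<le> fa_integral \<mu> \<phi>" "fa_integral \<nu> \<kappa> \<le> fa_integral \<nu> \<psi>"
      by (intro fa_integral_mono \<mu> \<nu> inB; simp add: \<kappa>_def)+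
    then have "fa_integral \<mu> \<kappa> \<le> lower_envelope \<A> \<mu> + e" "fa_integral \<nu> \<kappa> \<le> lower_envelope \<A> \<nu> + e"
      using \<phi>(2) \<psi>(2) by linarith+
    then have "t * fa_integral \<mu> \<kappa> + (1 - t) * fa_integral \<nu> \<kappa>
        \<le> t * (lower_envelope \<A> \<mu> + e) + (1 - t) * (lower_envelope \<A> \<nu> + e)"
      using t by (intro add_mono mult_left_mono) auto
    also have "\<dots> = t * lower_envelope \<A> \<mu> + (1 - t) * lower_envelope \<A> \<nu> + e"
      by (simp add: algebra_simps)
    finally show "lower_envelope \<A> ?\<rho> \<le> t * lower_envelope \<A> \<mu> + (1 - t) * lower_envelope \<A> \<nu> + e"
      using lower_envelope_le[OF Pa_convex[OF \<mu> \<nu> t] \<kappa>] fa_integral_convex[OF \<mu> \<nu> t inB(3)] by linarith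
  qed
qed

lemma lower_envelope_usc: "usc_on_Pa (lower_envelope \<A>)"
  unfolding usc_on_Pa_def
proof (intro ballI allI impI)
  fix \<mu> :: "'a set \<Rightarrow> real" and e :: real
  assume \<mu>: "\<mu> \<in> Pa" and e: "e > 0"
  then have e2: "e / 2 > 0" by simp
  obtain \<phi> where \<phi>: "\<phi> \<in> \<A>" "fa_integral \<mu> \<phi> < lower_envelope \<A> \<mu> + e / 2"
    using lower_envelope_approx[OF e2] by blast
  have \<phi>B: "\<phi> \<in> Bm" using Bm \<phi>(1) by auto
  then have "bounded (range \<phi>)" by (simp add: Bm_def)
  then obtain C where C: "C > 0" "\<And>x. \<bar>\<phi> x\<bar> \<le> C" by (auto simp: bounded_pos)
  show "\<exists>\<delta>>0. \<forall>\<nu>\<in>Pa. tv_dist \<nu> \<mu> < \<delta> \<longrightarrow> lower_envelope \<A> \<nu> < lower_envelope \<A> \<mu> + e"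
  proof (intro exI[of _ "e / 2 / C"] conjI ballI impI)
    show "0 < e / 2 / C" using e C(1) by simp
    fix \<nu> :: "'a set \<Rightarrow> real" assume \<nu>: "\<nu> \<in> Pa" and tv: "tv_dist \<nu> \<mu> < e / 2 / C"
    have "C * tv_dist \<nu> \<mu> < e / 2" using tv C(1) by (simp add: field_simps)
    then show "lower_envelope \<A> \<nu> < lower_envelope \<A> \<mu> + e"
      using fa_integral_tv_le[OF \<mu> \<nu> \<phi>B C(2,1)] lower_envelope_le[OF \<nu> \<phi>(1)] \<phi>(2) by linarith
  qed
qed

end

section \<open>Separated sets and partition sums\<close>

lemma le_bowen_dist_iff:
  "\<epsilon> \<le> bowen_dist f n x z \<longleftrightarrow> (\<exists>j\<le>n. \<epsilon> \<le> dist ((f ^^ j) x) ((f ^^ j) z))"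
  unfolding bowen_dist_def by (subst Max_ge_iff) auto

lemma bowen_dist_commute: "bowen_dist f n x z = bowen_dist f n z x"
  unfolding bowen_dist_def by (simp add: dist_commute)

lemma bowen_dist_self: "bowen_dist f n x x = 0"
  unfolding bowen_dist_def by simp

lemma separated_empty: "separated f n \<epsilon> {}"
  by (simp add: separated_def)

lemma separated_singleton: "separated f n \<epsilon> {x}"
  by (simp add: separated_def)

lemma separated_antimono: "separated f n \<epsilon> E \<Longrightarrow> \<delta> \<le> \<epsilon> \<Longrightarrow> separated f n \<delta> E"
  unfolding separated_def by (meson order_trans)

text \<open>
  Choosing a point with the largest weight, discarding the points close to it and repeating gives a
  separated set whose points represent all of \<open>E\<close> without loss of weight. With this choice, sums of
  \<open>exp (\<Phi> n x)\<close> are compared without any control on the oscillation of \<open>\<Phi> n\<close> on Bowen balls, which is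
  not available for sub-additive sequences.
\<close>

lemma greedy_separated_subset:
  assumes "finite E" "\<rho> > 0"
  shows "\<exists>F\<subseteq>E. separated f n \<rho> F \<and> (\<forall>x\<in>E. \<exists>y\<in>F. bowen_dist f n x y < \<rho> \<and> g x \<le> (g y :: real))"
  using assms(1)
proof (induction E rule: finite_psubset_induct)
  case (psubset E)
  show ?case
  proof (cases "E = {}")
    case True
    then show ?thesis using separated_empty by auto
  next
    case False
    then have "Max (g ` E) \<in> g ` E" using psubset.hyps by (intro Max_in) auto
    then obtain y where y: "y \<in> E" "g y = Max (g ` E)" by auto
    have gy: "g x \<le> g y" if "x \<in> E" for x
      unfolding y(2) using psubset.hyps that by (intro Max_ge) auto
    let ?E = "{x \<in> E. \<rho> \<le> bowen_dist f n x y}"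
    have "y \<notin> ?E" using assms(2) by (simp add: bowen_dist_self)
    then have "?E \<subset> E" using y(1) by blast
    from psubset.IH[OF this] obtain F where F: "F \<subseteq> ?E" "separated f n \<rho> F"
      "\<forall>x\<in>?E. \<exists>y\<in>F. bowen_dist f n x y < \<rho> \<and> g x \<le> g y" by blast
    have Fy: "\<rho> \<le> bowen_dist f n z y" "\<rho> \<le> bowen_dist f n y z" if "z \<in> F" for z
      using F(1) that bowen_dist_commute[of f n y z] by auto
    have FF: "\<rho> \<le> bowen_dist f n z z'" if "z \<in> F" "z' \<in> F" "z \<noteq> z'" for z z'
      using F(2) that unfolding separated_def by blast
    have "separated f n \<rho> (insert y F)"
      unfolding separated_def
    proof (intro ballI impI)
      fix a b assume "a \<in> insert y F" "b \<in> insert y F" "a \<noteq> b"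
      then show "\<rho> \<le> bowen_dist f n a b" using Fy FF by (elim insertE) simp_all
    qed
    moreover have "\<exists>z\<in>insert y F. bowen_dist f n x z < \<rho> \<and> g x \<le> g z" if "x \<in> E" for x
    proof (cases "x \<in> ?E")
      case True
      then show ?thesis using F(3) by blast
    next
      case False
      then have "bowen_dist f n x y < \<rho>" using that by simp
      then show ?thesis using gy[OF that] by blast
    qed
    moreover have "insert y F \<subseteq> E" using F(1) y(1) by blast
    ultimately show ?thesis by (intro exI[of _ "insert y F"]) simp
  qed
qed

text \<open>
  The quantity inside the pressure, for an arbitrary weight in place of \<open>exp \<circ> \<Phi> n\<close>; the counting
  argument applies it to weights that are rescaled by the pressure.
\<close>

definition partition_sum :: "('a::metric_space \<Rightarrow> 'a) \<Rightarrow> nat \<Rightarrow> real \<Rightarrow> ('a \<Rightarrow> real) \<Rightarrow> real" where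
  "partition_sum f n \<epsilon> g = (SUP E\<in>{E. separated f n \<epsilon> E}. \<Sum>x\<in>E. g x)"

definition pressure_at :: "('a::metric_space \<Rightarrow> 'a) \<Rightarrow> (nat \<Rightarrow> 'a \<Rightarrow> real) \<Rightarrow> real \<Rightarrow> ereal" where
  "pressure_at f \<Phi> \<epsilon> = limsup (\<lambda>n. ereal (ln (partition_sum f n \<epsilon> (\<lambda>x. exp (\<Phi> n x))) / real n))"

lemma pressure_eq_Lim: "pressure f \<Phi> = Lim (at_right 0) (pressure_at f \<Phi>)"
  unfolding pressure_def pressure_at_def partition_sum_def ..

lemma partition_sum_le:
  assumes "\<And>E. separated f n \<epsilon> E \<Longrightarrow> (\<Sum>x\<in>E. g x) \<le> b"
  shows "partition_sum f n \<epsilon> g \<le> b"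
  unfolding partition_sum_def using assms separated_empty by (intro cSUP_least) blast+

locale compact_system =
  fixes f :: "'a::metric_space \<Rightarrow> 'a"
  assumes compact_space: "compact (UNIV :: 'a set)"
    and cont: "continuous_on UNIV f"
begin

lemma continuous_on_funpow: "continuous_on UNIV (f ^^ k)"
proof (induction k)
  case (Suc k)
  then show ?case using continuous_on_compose[of UNIV "f ^^ k" f] cont continuous_on_subset
    by (metis funpow.simps(2) subset_UNIV)
qed (simp add: id_def)

lemma bounded_continuous:
  assumes "continuous_on UNIV (g :: 'a \<Rightarrow> real)"
  obtains B where "B > 0" "\<And>x. \<bar>g x\<bar> \<le> B"
proof -
  have "bounded (range g)"
    using compact_continuous_image[OF assms compact_space] by (rule compact_imp_bounded)
  then obtain B where "B > 0" "\<forall>x\<in>range g. norm x \<le> B" unfolding bounded_pos by blast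
  then show ?thesis using that by simp
qed

text \<open>
  By compactness, finitely many colours suffice for points of equal colour to stay close up to time
  \<open>n\<close>. This bounds the cardinality of separated sets and, in the counting argument, the cost of
  the first \<open>k\<close> steps of an orbit.
\<close>

lemma small_coloring:
  assumes "\<rho> > 0"
  shows "\<exists>c :: 'a \<Rightarrow> nat. \<exists>K. (\<forall>x. c x < K) \<and>
    (\<forall>x y. c x = c y \<longrightarrow> (\<forall>j\<le>n. dist ((f ^^ j) x) ((f ^^ j) y) < \<rho>))"
proof -
  let ?V = "\<lambda>y. \<Inter>j\<in>{..n}. {z. dist ((f ^^ j) z) ((f ^^ j) y) < \<rho> / 2}"
  have op: "open (?V y)" for y
    by (intro open_INT open_Collect_less continuous_on_dist continuous_on_funpow
        continuous_on_const finite_atMost ballI)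
  have cov: "UNIV \<subseteq> (\<Union>y\<in>UNIV. ?V y)" using assms by auto
  obtain Y where Y: "finite Y" "UNIV \<subseteq> (\<Union>y\<in>Y. ?V y)"
    by (rule compactE_image[OF compact_space op cov])
  have "\<forall>x. \<exists>y. y \<in> Y \<and> x \<in> ?V y" using Y(2) by blast
  from choice[OF this] obtain p where "\<forall>x. p x \<in> Y \<and> x \<in> ?V (p x)" ..
  then have p: "\<And>x. p x \<in> Y" "\<And>x. x \<in> ?V (p x)" by auto
  obtain g :: "'a \<Rightarrow> nat" and K where g: "g ` Y = {i. i < K}" "inj_on g Y"
    using finite_imp_inj_to_nat_seg[OF Y(1)] by blast
  show ?thesis
  proof (intro exI[of _ "\<lambda>x. g (p x)"] exI[of _ K] conjI allI impI)
    show "g (p x) < K" for x using g(1) p(1)[of x] by blast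
    fix x y j assume *: "g (p x) = g (p y)" "j \<le> n"
    then have "p x = p y" using g(2) p(1) by (meson inj_onD)
    then have "dist ((f ^^ j) x) ((f ^^ j) (p x)) < \<rho> / 2" "dist ((f ^^ j) y) ((f ^^ j) (p x)) < \<rho> / 2"
      using p(2)[of x] p(2)[of y] *(2) by auto
    then show "dist ((f ^^ j) x) ((f ^^ j) y) < \<rho>"
      by (rule dist_triangle_half_l)
  qed
qed

lemma separated_card_bounded:
  assumes "\<epsilon> > 0"
  obtains K where "\<And>E. separated f n \<epsilon> E \<Longrightarrow> finite E \<and> card E \<le> K"
proof -
  obtain c :: "'a \<Rightarrow> nat" and K where c: "\<And>x. c x < K"
    "\<And>x y. c x = c y \<Longrightarrow> \<forall>j\<le>n. dist ((f ^^ j) x) ((f ^^ j) y) < \<epsilon>"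
    using small_coloring[OF assms, of n] by blast
  have "finite E \<and> card E \<le> K" if "separated f n \<epsilon> E" for E
  proof -
    have "inj_on c E"
    proof (rule inj_onI)
      fix x y assume xy: "x \<in> E" "y \<in> E" "c x = c y"
      then have "\<not> \<epsilon> \<le> bowen_dist f n x y"
        unfolding le_bowen_dist_iff using c(2)[OF xy(3)] by (meson not_le)
      then show "x = y" using that xy unfolding separated_def by blast
    qed
    moreover have "c ` E \<subseteq> {..<K}" using c(1) by auto
    ultimately show ?thesis
      using inj_on_finite[of c E "{..<K}"] card_inj_on_le[of c E "{..<K}"] by simp
  qed
  then show ?thesis using that by blast
qed

lemma separated_finite: "\<epsilon> > 0 \<Longrightarrow> separated f n \<epsilon> E \<Longrightarrow> finite E"
  by (meson separated_card_bounded)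

lemma sum_le_partition_sum:
  assumes "\<epsilon> > 0" "separated f n \<epsilon> E" "continuous_on UNIV g"
  shows "(\<Sum>x\<in>E. g x) \<le> partition_sum f n \<epsilon> g"
proof -
  obtain B where B: "B > 0" "\<And>x. \<bar>g x\<bar> \<le> B" by (rule bounded_continuous[OF assms(3)]) blast
  obtain K where K: "\<And>E. separated f n \<epsilon> E \<Longrightarrow> finite E \<and> card E \<le> K"
    by (rule separated_card_bounded[OF assms(1)]) blast
  have "(\<Sum>x\<in>E. g x) \<le> real K * B" if "separated f n \<epsilon> E" for E
  proof -
    have "g x \<le> B" for x using B(2)[of x] by linarith
    then have "(\<Sum>x\<in>E. g x) \<le> real (card E) * B" by (simp add: sum_bounded_above)
    also have "\<dots> \<le> real K * B" using K[OF that] B(1) by (intro mult_right_mono) auto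
    finally show ?thesis .
  qed
  then show ?thesis unfolding partition_sum_def using assms(2)
    by (intro cSUP_upper) (auto intro!: bdd_aboveI2)
qed

lemma partition_sum_antimono:
  assumes "0 < \<delta>" "\<delta> \<le> \<epsilon>" "continuous_on UNIV g"
  shows "partition_sum f n \<epsilon> g \<le> partition_sum f n \<delta> g"
  by (rule partition_sum_le)
    (rule sum_le_partition_sum[OF assms(1) separated_antimono[OF _ assms(2)] assms(3)])

lemma exp_le_partition_sum:
  assumes "\<epsilon> > 0" "continuous_on UNIV (\<phi> :: 'a \<Rightarrow> real)"
  shows "exp (\<phi> x) \<le> partition_sum f n \<epsilon> (\<lambda>x. exp (\<phi> x))"
  using sum_le_partition_sum[OF assms(1) separated_singleton[of f n \<epsilon> x], of "\<lambda>x. exp (\<phi> x)"]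
    continuous_on_exp[OF assms(2)] by simp

lemma partition_sum_exp_pos:
  assumes "\<epsilon> > 0" "continuous_on UNIV (\<phi> :: 'a \<Rightarrow> real)"
  shows "0 < partition_sum f n \<epsilon> (\<lambda>x. exp (\<phi> x))"
  using less_le_trans[OF exp_gt_zero exp_le_partition_sum[OF assms]] .

lemma pressure_at_antimono:
  assumes "0 < \<delta>" "\<delta> \<le> \<epsilon>" and c: "\<And>n. n \<ge> 1 \<Longrightarrow> continuous_on UNIV (\<Phi> n)"
  shows "pressure_at f \<Phi> \<epsilon> \<le> pressure_at f \<Phi> \<delta>"
  unfolding pressure_at_def
proof (rule Limsup_mono)
  show "\<forall>\<^sub>F n in sequentially. ereal (ln (partition_sum f n \<epsilon> (\<lambda>x. exp (\<Phi> n x))) / real n)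
      \<le> ereal (ln (partition_sum f n \<delta> (\<lambda>x. exp (\<Phi> n x))) / real n)"
    using eventually_ge_at_top[of 1]
  proof eventually_elim
    case (elim n)
    have "partition_sum f n \<epsilon> (\<lambda>x. exp (\<Phi> n x)) \<le> partition_sum f n \<delta> (\<lambda>x. exp (\<Phi> n x))"
      using assms(1,2) c[OF elim] by (intro partition_sum_antimono continuous_on_exp)
    moreover have "0 < partition_sum f n \<epsilon> (\<lambda>x. exp (\<Phi> n x))"
      using assms(1,2) c[OF elim] by (intro partition_sum_exp_pos) auto
    ultimately show ?case by (auto intro!: divide_right_mono)
  qed
qed

lemma pressure_at_tendsto:
  assumes "\<And>n. n \<ge> 1 \<Longrightarrow> continuous_on UNIV (\<Phi> n)"
  shows "(pressure_at f \<Phi> \<longlongrightarrow> (SUP \<epsilon>\<in>{0<..}. pressure_at f \<Phi> \<epsilon>)) (at_right 0)"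
proof (rule order_tendstoI)
  fix a assume "a < (SUP \<epsilon>\<in>{0<..}. pressure_at f \<Phi> \<epsilon>)"
  then obtain \<delta> where \<delta>: "\<delta> > 0" "a < pressure_at f \<Phi> \<delta>" by (auto simp: less_SUP_iff)
  have "\<forall>\<^sub>F \<epsilon> in at_right 0. \<epsilon> \<in> {0<..<\<delta>}" using \<delta>(1) by (intro eventually_at_right_real)
  then show "\<forall>\<^sub>F \<epsilon> in at_right 0. a < pressure_at f \<Phi> \<epsilon>"
  proof eventually_elim
    case (elim \<epsilon>)
    then show ?case using pressure_at_antimono[of \<epsilon> \<delta> \<Phi>] assms \<delta>(2) by (auto intro: less_le_trans)
  qed
next
  fix a assume a: "(SUP \<epsilon>\<in>{0<..}. pressure_at f \<Phi> \<epsilon>) < a"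
  have "\<forall>\<^sub>F \<epsilon> in at_right (0::real). \<epsilon> \<in> {0<..<1}" by (intro eventually_at_right_real) simp
  then show "\<forall>\<^sub>F \<epsilon> in at_right 0. pressure_at f \<Phi> \<epsilon> < a"
  proof eventually_elim
    case (elim \<epsilon>)
    then show ?case using SUP_upper[of \<epsilon> "{0<..}" "pressure_at f \<Phi>"] a by (auto intro: le_less_trans)
  qed
qed

lemma pressure_eq_SUP:
  assumes "\<And>n. n \<ge> 1 \<Longrightarrow> continuous_on UNIV (\<Phi> n)"
  shows "pressure f \<Phi> = (SUP \<epsilon>\<in>{0<..}. pressure_at f \<Phi> \<epsilon>)"
  unfolding pressure_eq_Lim using pressure_at_tendsto[OF assms]
  by (intro tendsto_Lim) (auto simp: trivial_limit_at_right_real)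

lemma partition_sum_one:
  assumes "\<epsilon> > 0"
  shows "partition_sum f n \<epsilon> (\<lambda>x. 1) = real (max_sep f n \<epsilon>)"
proof (rule antisym)
  obtain K where K: "\<And>E. separated f n \<epsilon> E \<Longrightarrow> finite E \<and> card E \<le> K"
    by (rule separated_card_bounded[OF assms]) blast
  let ?C = "{card E |E. separated f n \<epsilon> E}"
  have fin: "finite ?C" by (rule finite_subset[of _ "{..K}"]) (use K in auto)
  show "partition_sum f n \<epsilon> (\<lambda>x. 1) \<le> real (max_sep f n \<epsilon>)"
  proof (rule partition_sum_le)
    fix E assume "separated f n \<epsilon> E"
    then show "(\<Sum>x\<in>E. 1) \<le> real (max_sep f n \<epsilon>)"
      unfolding max_sep_def using fin by (auto intro!: Max_ge)
  qed
  have "?C \<noteq> {}" using separated_empty by blast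
  then have "Max ?C \<in> ?C" using fin by (intro Max_in)
  then obtain E where E: "max_sep f n \<epsilon> = card E" "separated f n \<epsilon> E"
    unfolding max_sep_def by auto
  show "real (max_sep f n \<epsilon>) \<le> partition_sum f n \<epsilon> (\<lambda>x. 1)"
    using sum_le_partition_sum[OF assms E(2), of "\<lambda>x. 1"] E(1) by simp
qed

text \<open>
  This allows the finiteness of the entropy to be used through the comparison of pressures.
\<close>

lemma topological_entropy_eq_pressure: "topological_entropy f = pressure f (\<lambda>n x. 0)"
proof -
  have "(pressure_at f (\<lambda>n x. 0) \<longlongrightarrow> pressure f (\<lambda>n x. 0)) (at_right 0)"
    using pressure_at_tendsto[of "\<lambda>n x. 0"] by (subst pressure_eq_SUP) auto
  moreover have "\<forall>\<^sub>F \<epsilon> in at_right 0. pressure_at f (\<lambda>n x. 0) \<epsilon>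
      = limsup (\<lambda>n. ereal (ln (real (max_sep f n \<epsilon>)) / real n))"
    using eventually_at_right_less[of "0::real"]
    by eventually_elim (simp add: pressure_at_def partition_sum_one)
  ultimately have "((\<lambda>\<epsilon>. limsup (\<lambda>n. ereal (ln (real (max_sep f n \<epsilon>)) / real n)))
      \<longlongrightarrow> pressure f (\<lambda>n x. 0)) (at_right 0)"
    by (rule Lim_transform_eventually)
  then show ?thesis unfolding topological_entropy_def
    by (intro tendsto_Lim) (auto simp: trivial_limit_at_right_real)
qed

end

section \<open>Sub-additive sequences\<close>

lemma Sb_continuous: "\<Phi> \<in> Sb f \<Longrightarrow> n \<ge> 1 \<Longrightarrow> continuous_on UNIV (\<Phi> n)"
  by (simp add: Sb_def subadditive_seq_def)

lemma Sb_subadditive: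
  "\<Phi> \<in> Sb f \<Longrightarrow> m \<ge> 1 \<Longrightarrow> n \<ge> 1 \<Longrightarrow> \<Phi> (m + n) x \<le> \<Phi> m x + \<Phi> n ((f ^^ m) x)"
  by (simp add: Sb_def subadditive_seq_def)

lemma Sb_zero: "(\<lambda>n x. 0) \<in> Sb f"
proof -
  have "(INF x::'a. INF n\<in>{1..}. ereal (0 / real n)) \<ge> 0"
    by (intro INF_greatest) simp
  then have "(INF x::'a. INF n\<in>{1..}. ereal (0 / real n)) > - \<infinity>"
    by (rule less_le_trans[rotated]) simp
  then show ?thesis by (simp add: Sb_def subadditive_seq_def)
qed

lemma Sb_lower_bound:
  assumes "\<Phi> \<in> Sb f"
  obtains c where "\<And>x n. n \<ge> 1 \<Longrightarrow> c \<le> \<Phi> n x / real n"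
proof -
  have "- \<infinity> < (INF x. INF n\<in>{1..}. ereal (\<Phi> n x / real n))" using assms by (simp add: Sb_def)
  from ereal_dense2[OF this] obtain c
    where c: "ereal c < (INF x. INF n\<in>{1..}. ereal (\<Phi> n x / real n))" by auto
  have "c \<le> \<Phi> n x / real n" if "n \<ge> 1" for n x
  proof -
    have "(INF x. INF n\<in>{1..}. ereal (\<Phi> n x / real n)) \<le> ereal (\<Phi> n x / real n)"
      using that by (intro INF_lower2[of x] INF_lower) auto
    then have "ereal c < ereal (\<Phi> n x / real n)" using c by (rule less_le_trans[rotated])
    then show ?thesis by simp
  qed
  then show ?thesis by (rule that)
qed

lemma Sb_bdd_below: "\<Phi> \<in> Sb f \<Longrightarrow> bdd_below ((\<lambda>n. \<Phi> n x / real n) ` {1..})"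
  by (rule Sb_lower_bound) (auto intro!: bdd_belowI2)

lemma psi_le: "\<Phi> \<in> Sb f \<Longrightarrow> n \<ge> 1 \<Longrightarrow> real n * psi \<Phi> x \<le> \<Phi> n x"
proof -
  assume a: "\<Phi> \<in> Sb f" "n \<ge> 1"
  then have "psi \<Phi> x \<le> \<Phi> n x / real n"
    unfolding psi_def by (intro cINF_lower Sb_bdd_below) auto
  then show ?thesis using a(2) by (simp add: field_simps)
qed

lemma psi_lessD:
  assumes "\<Phi> \<in> Sb f" "psi \<Phi> x < c"
  obtains n where "n \<ge> 1" "\<Phi> n x < real n * c"
proof -
  have "\<exists>n\<in>{1..}. \<Phi> n x / real n < c"
    using assms(2) unfolding psi_def by (subst (asm) cINF_less_iff[OF _ Sb_bdd_below[OF assms(1)]]) auto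
  then obtain n where n: "n \<ge> 1" "\<Phi> n x / real n < c" by auto
  then have "\<Phi> n x < real n * c" by (simp add: field_simps)
  then show ?thesis using n(1) that by blast
qed

context compact_system
begin

lemma Sb_upper_bound:
  assumes "\<Phi> \<in> Sb f"
  obtains D where "\<And>n x. n \<ge> 1 \<Longrightarrow> \<Phi> n x \<le> real n * D"
proof -
  obtain D where D: "D > 0" "\<And>x. \<bar>\<Phi> 1 x\<bar> \<le> D"
    using bounded_continuous[OF Sb_continuous[OF assms order_refl]] by blast
  have "\<Phi> n x \<le> real n * D" if "n \<ge> 1" for n x
    using that
  proof (induction n rule: dec_induct)
    case base
    then show ?case using D(2)[of x] by simp
  next
    case (step n)
    have "\<Phi> (n + 1) x \<le> \<Phi> n x + \<Phi> 1 ((f ^^ n) x)"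
      using step.hyps by (intro Sb_subadditive[OF assms]) auto
    then show ?case using step.IH D(2)[of "(f ^^ n) x"] by (simp add: algebra_simps)
  qed
  then show ?thesis by (rule that)
qed

lemma psi_bounded:
  assumes "\<Phi> \<in> Sb f"
  obtains c D where "\<And>x. c \<le> psi \<Phi> x" "\<And>x. psi \<Phi> x \<le> D"
proof -
  obtain c where c: "\<And>x n. n \<ge> 1 \<Longrightarrow> c \<le> \<Phi> n x / real n" by (rule Sb_lower_bound[OF assms]) blast
  obtain D where D: "\<And>n x. n \<ge> 1 \<Longrightarrow> \<Phi> n x \<le> real n * D" by (rule Sb_upper_bound[OF assms]) blast
  have "c \<le> psi \<Phi> x" for x unfolding psi_def using c by (intro cINF_greatest) auto
  moreover have "psi \<Phi> x \<le> D" for x using psi_le[OF assms order_refl, of x] D[OF order_refl, of x] by simp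
  ultimately show ?thesis by (rule that)
qed

lemma psi_Bm:
  assumes "\<Phi> \<in> Sb f"
  shows "psi \<Phi> \<in> Bm"
proof -
  have "(\<lambda>x. INF n\<in>{1..}. \<Phi> n x / real n) \<in> borel_measurable borel"
  proof (rule borel_measurable_cINF)
    fix n :: nat assume "n \<in> {1..}"
    then have "\<Phi> n \<in> borel_measurable borel"
      using Sb_continuous[OF assms] by (intro borel_measurable_continuous_onI) auto
    then show "(\<lambda>x. \<Phi> n x / real n) \<in> borel_measurable borel" by measurable
  qed (use Sb_bdd_below[OF assms] in auto)
  moreover obtain c D where "\<And>x. c \<le> psi \<Phi> x" "\<And>x. psi \<Phi> x \<le> D"
    by (rule psi_bounded[OF assms]) blast
  then have "\<bar>psi \<Phi> x\<bar> \<le> max \<bar>c\<bar> \<bar>D\<bar>" for x by (smt (verit))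
  then have "bounded (range (psi \<Phi>))" by (auto simp: bounded_iff)
  ultimately show ?thesis by (simp add: Bm_def psi_def[abs_def])
qed

text \<open>
  A single point is a separated set, and \<open>n \<psi>\<^sub>\<Phi>(x) \<le> \<phi>\<^sub>n(x)\<close>.
\<close>

lemma psi_le_pressure:
  assumes "\<Phi> \<in> Sb f"
  shows "ereal (psi \<Phi> x) \<le> pressure f \<Phi>"
proof -
  have "ereal (psi \<Phi> x) \<le> pressure_at f \<Phi> 1"
    unfolding pressure_at_def
  proof (rule le_Limsup)
    show "\<forall>\<^sub>F n in sequentially.
        ereal (psi \<Phi> x) \<le> ereal (ln (partition_sum f n 1 (\<lambda>x. exp (\<Phi> n x))) / real n)"
      using eventually_ge_at_top[of 1]
    proof eventually_elim
      case (elim n)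
      note c = Sb_continuous[OF assms elim]
      have "ln (exp (\<Phi> n x)) \<le> ln (partition_sum f n 1 (\<lambda>x. exp (\<Phi> n x)))"
        by (intro ln_mono exp_gt_zero exp_le_partition_sum c) auto
      then have "real n * psi \<Phi> x \<le> ln (partition_sum f n 1 (\<lambda>x. exp (\<Phi> n x)))"
        using psi_le[OF assms elim, of x] by simp
      then show ?case using elim by (simp add: field_simps)
    qed
  qed simp
  also have "\<dots> \<le> pressure f \<Phi>"
    by (subst pressure_eq_SUP) (auto intro: SUP_upper Sb_continuous[OF assms])
  finally show ?thesis .
qed

text \<open>
  Since \<open>\<phi>\<^sub>n \<le> n D\<close> with \<open>D\<close> a bound for \<open>\<phi>\<^sub>1\<close>, the pressure is at most the entropy plus \<open>D\<close>.
\<close>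

lemma pressure_finite:
  assumes "\<Phi> \<in> Sb f" "topological_entropy f < \<infinity>"
  shows "\<bar>pressure f \<Phi>\<bar> \<noteq> \<infinity>"
proof -
  obtain D where D: "\<And>n x. n \<ge> 1 \<Longrightarrow> \<Phi> n x \<le> real n * D" by (rule Sb_upper_bound[OF assms(1)]) blast
  have "pressure_at f \<Phi> \<epsilon> \<le> topological_entropy f + ereal D" if \<epsilon>: "\<epsilon> > 0" for \<epsilon>
  proof -
    let ?Z = "\<lambda>n. partition_sum f n \<epsilon> (\<lambda>x. exp (\<Phi> n x))"
    let ?N = "\<lambda>n. partition_sum f n \<epsilon> (\<lambda>x. exp 0)"
    have "\<forall>\<^sub>F n in sequentially. ereal (ln (?Z n) / real n) \<le> ereal (ln (?N n) / real n) + ereal D"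
      using eventually_ge_at_top[of 1]
    proof eventually_elim
      case (elim n)
      have N: "?N n > 0" by (intro partition_sum_exp_pos \<epsilon>) auto
      have Z: "?Z n > 0" by (intro partition_sum_exp_pos \<epsilon> Sb_continuous[OF assms(1) elim])
      have "?Z n \<le> ?N n * exp (real n * D)"
      proof (rule partition_sum_le)
        fix E assume E: "separated f n \<epsilon> E"
        have "(\<Sum>x\<in>E. exp (\<Phi> n x)) \<le> (\<Sum>x\<in>E. exp 0 * exp (real n * D))"
          using D[OF elim] by (intro sum_mono) simp
        also have "\<dots> = (\<Sum>x\<in>E. exp 0) * exp (real n * D)" by (rule sum_distrib_right[symmetric])
        also have "\<dots> \<le> ?N n * exp (real n * D)"
          using sum_le_partition_sum[OF \<epsilon> E, of "\<lambda>x. exp 0"] by (intro mult_right_mono) auto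
        finally show "(\<Sum>x\<in>E. exp (\<Phi> n x)) \<le> ?N n * exp (real n * D)" .
      qed
      then have "ln (?Z n) \<le> ln (?N n * exp (real n * D))" using Z by (intro ln_mono) auto
      also have "\<dots> = ln (?N n) + real n * D" using N by (simp add: ln_mult)
      finally have "ln (?Z n) / real n \<le> (ln (?N n) + real n * D) / real n"
        by (rule divide_right_mono) simp
      also have "\<dots> = ln (?N n) / real n + D" using elim by (simp add: add_divide_distrib)
      finally show ?case by simp
    qed
    then have "pressure_at f \<Phi> \<epsilon> \<le> limsup (\<lambda>n. ereal (ln (?N n) / real n) + ereal D)"
      unfolding pressure_at_def by (rule Limsup_mono)
    also have "\<dots> = pressure_at f (\<lambda>n x. 0) \<epsilon> + ereal D"
      unfolding pressure_at_def by (rule Limsup_add_ereal_right) auto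
    also have "\<dots> \<le> topological_entropy f + ereal D"
    proof (rule add_right_mono)
      show "pressure_at f (\<lambda>n x. 0) \<epsilon> \<le> topological_entropy f"
        unfolding topological_entropy_eq_pressure
        using \<epsilon> by (subst pressure_eq_SUP) (auto intro: SUP_upper)
    qed
    finally show ?thesis .
  qed
  then have "pressure f \<Phi> \<le> topological_entropy f + ereal D"
    by (subst pressure_eq_SUP) (auto intro: SUP_least Sb_continuous[OF assms(1)])
  then have "pressure f \<Phi> < \<infinity>" using assms(2) by (auto simp: le_less_trans)
  moreover have "pressure f \<Phi> > - \<infinity>"
    using psi_le_pressure[OF assms(1), of undefined] by (rule less_le_trans[rotated]) simp
  ultimately show ?thesis by auto
qed

text \<open>
  Let \<open>s\<close> be the supremum of \<open>\<psi>\<^sub>\<Phi>\<close> along the orbit. From every point of the orbit there is a block on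
  which the average of \<open>\<Phi>\<close> is less than \<open>s + \<delta>/2\<close>; by sub-additivity, concatenating such blocks gives arbitrarily
  long ones starting at \<open>x\<close>. It remains to take \<open>k\<close> with \<open>\<psi>\<^sub>\<Phi>(f\<^sup>k x) > s - \<delta>/2\<close>. The passage to \<open>f\<^sup>k x\<close> is needed because
  a small value of \<open>\<psi>\<^sub>\<Phi>\<close> at \<open>x\<close> itself may come from short times only.
\<close>

lemma infinitely_often_near_psi:
  assumes \<Phi>: "\<Phi> \<in> Sb f" and "\<delta> > 0"
  shows "\<exists>k. \<forall>N. \<exists>n\<ge>N. n \<ge> 1 \<and> \<Phi> n x < real n * (psi \<Phi> ((f ^^ k) x) + \<delta>)"
proof -
  obtain c D where "\<And>x. c \<le> psi \<Phi> x" and D: "\<And>x. psi \<Phi> x \<le> D"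
    by (rule psi_bounded[OF \<Phi>]) blast
  define s where "s = (SUP k. psi \<Phi> ((f ^^ k) x))"
  have bdd: "bdd_above (range (\<lambda>k. psi \<Phi> ((f ^^ k) x)))" using D by (auto intro!: bdd_aboveI2)
  have "s - \<delta> / 2 < s" using assms(2) by simp
  then obtain k where k: "s - \<delta> / 2 < psi \<Phi> ((f ^^ k) x)"
    unfolding s_def using less_cSUP_iff[OF _ bdd] by auto
  have step: "\<exists>m\<ge>1. \<Phi> m ((f ^^ n) x) < real m * (s + \<delta> / 2)" for n
  proof -
    have "psi \<Phi> ((f ^^ n) x) \<le> s" unfolding s_def by (rule cSUP_upper[OF _ bdd]) simp
    then have "psi \<Phi> ((f ^^ n) x) < s + \<delta> / 2" using assms(2) by linarith
    then show ?thesis using psi_lessD[OF \<Phi>] by metis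
  qed
  have ex: "\<exists>n\<ge>N. n \<ge> 1 \<and> \<Phi> n x < real n * (s + \<delta> / 2)" for N
  proof (induction N)
    case 0
    then show ?case using step[of 0] by auto
  next
    case (Suc N)
    then obtain n where n: "n \<ge> N" "n \<ge> 1" "\<Phi> n x < real n * (s + \<delta> / 2)" by blast
    obtain m where m: "m \<ge> 1" "\<Phi> m ((f ^^ n) x) < real m * (s + \<delta> / 2)" using step by blast
    have "\<Phi> (n + m) x < real n * (s + \<delta> / 2) + real m * (s + \<delta> / 2)"
      using Sb_subadditive[OF \<Phi> n(2) m(1), of x] n(3) m(2) by linarith
    then have "\<Phi> (n + m) x < real (n + m) * (s + \<delta> / 2)" by (simp only: of_nat_add distrib_right)
    then show ?case using n(1) m(1) by (intro exI[of _ "n + m"]) auto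
  qed
  show ?thesis
  proof (rule exI[of _ k], rule allI)
    fix N
    obtain n where n: "n \<ge> N" "n \<ge> 1" "\<Phi> n x < real n * (s + \<delta> / 2)" using ex by blast
    have "real n * (s + \<delta> / 2) \<le> real n * (psi \<Phi> ((f ^^ k) x) + \<delta>)"
      using k by (intro mult_left_mono) auto
    with n show "\<exists>n\<ge>N. n \<ge> 1 \<and> \<Phi> n x < real n * (psi \<Phi> ((f ^^ k) x) + \<delta>)"
      by (intro exI[of _ n] conjI) linarith+
  qed
qed

end

section \<open>Counting orbits block by block\<close>

context compact_system
begin

text \<open>
  Peeling off the first block of length \<open>n\<close> of orbits of length \<open>r\<close>. Group the points of \<open>E\<close> by
  their colour, which fixes the times up to \<open>k\<close> within \<open>\<eta>\<close>, and by a greedily chosen \<open>\<eta>/2\<close>-close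
  representative of the times from \<open>k\<close> to \<open>n + k\<close>. Two points in a group are close up to time \<open>n + k\<close>, so
  they are separated after time \<open>n\<close>, and at the original scale \<open>\<eta>\<close>. Only the weight of the block is measured
  at scale \<open>\<eta>/2\<close>; therefore the estimate can be iterated.
\<close>

lemma sum_over_separated_split:
  assumes \<eta>: "\<eta> > 0" and E: "separated f r \<eta> E" and r: "n < r"
    and g: "continuous_on UNIV g" "\<And>z. 0 \<le> g z" and v: "\<And>z. 0 \<le> v z" and C: "C \<ge> 0"
    and w: "\<And>x. x \<in> E \<Longrightarrow> w x \<le> g ((f ^^ k) x) * v ((f ^^ n) x)"
    and col: "\<And>x. c x < (K :: nat)"
      "\<And>x y j. c x = c y \<Longrightarrow> j \<le> k \<Longrightarrow> dist ((f ^^ j) x) ((f ^^ j) y) < \<eta>"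
    and IH: "\<And>E'. separated f (r - n) \<eta> E' \<Longrightarrow> (\<Sum>z\<in>E'. v z) \<le> C"
  shows "(\<Sum>x\<in>E. w x) \<le> real K * partition_sum f n (\<eta> / 2) g * C"
proof -
  have fin: "finite E" using separated_finite[OF \<eta> E] .
  have \<eta>2: "\<eta> / 2 > 0" using \<eta> by simp
  have "finite ((f ^^ k) ` E)" using fin by simp
  from greedy_separated_subset[OF this \<eta>2, of f n g] obtain F where
    F: "F \<subseteq> (f ^^ k) ` E" "separated f n (\<eta> / 2) F"
    and "\<forall>z\<in>(f ^^ k) ` E. \<exists>y\<in>F. bowen_dist f n z y < \<eta> / 2 \<and> g z \<le> g y" by blast
  then have "\<forall>x\<in>E. \<exists>y. y \<in> F \<and> bowen_dist f n ((f ^^ k) x) y < \<eta> / 2 \<and> g ((f ^^ k) x) \<le> g y"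
    by blast
  from bchoice[OF this] obtain p where
    "\<forall>x\<in>E. p x \<in> F \<and> bowen_dist f n ((f ^^ k) x) (p x) < \<eta> / 2 \<and> g ((f ^^ k) x) \<le> g (p x)" ..
  then have p: "p x \<in> F" "bowen_dist f n ((f ^^ k) x) (p x) < \<eta> / 2" "g ((f ^^ k) x) \<le> g (p x)"
    if "x \<in> E" for x using that by auto
  have finF: "finite F" using F(1) fin by (meson finite_imageI finite_subset)
  let ?q = "\<lambda>x. (c x, p x)"
  have cell: "(\<Sum>x\<in>{x \<in> E. ?q x = (i, y)}. v ((f ^^ n) x)) \<le> C" for i y
  proof -
    let ?A = "{x \<in> E. ?q x = (i, y)}"
    have far: "\<exists>j\<le>r - n. \<eta> \<le> dist ((f ^^ j) ((f ^^ n) x)) ((f ^^ j) ((f ^^ n) x'))"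
      if x: "x \<in> ?A" "x' \<in> ?A" "x \<noteq> x'" for x x'
    proof -
      have "\<eta> \<le> bowen_dist f r x x'" using E x unfolding separated_def by auto
      then obtain j where j: "j \<le> r" "\<eta> \<le> dist ((f ^^ j) x) ((f ^^ j) x')"
        unfolding le_bowen_dist_iff by blast
      have "k < j" using col(2)[of x x' j] x j(2) by (auto simp: not_le[symmetric])
      \<comment> \<open>From time \<open>k\<close> to \<open>n + k\<close> both orbits are within \<open>\<eta>/2\<close> of that of the common representative.\<close>
      have "n + k < j"
      proof (rule ccontr)
        assume "\<not> n + k < j"
        then have "j - k \<le> n" by simp
        have "dist ((f ^^ (j - k)) ((f ^^ k) z)) ((f ^^ (j - k)) y) < \<eta> / 2" if "z \<in> ?A" for z
        proof -
          have "\<not> \<eta> / 2 \<le> bowen_dist f n ((f ^^ k) z) y" using p(2)[of z] that by auto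
          then show ?thesis using \<open>j - k \<le> n\<close> unfolding le_bowen_dist_iff by (meson not_le)
        qed
        moreover have "(f ^^ (j - k)) ((f ^^ k) z) = (f ^^ j) z" for z
          using funpow_add[of "j - k" k f] \<open>k < j\<close> by (metis comp_apply le_add_diff_inverse2 less_imp_le)
        ultimately have "dist ((f ^^ j) z) ((f ^^ (j - k)) y) < \<eta> / 2" if "z \<in> ?A" for z
          using that by metis
        from dist_triangle_half_l[OF this[OF x(1)] this[OF x(2)]] show False
          using j(2) by simp
      qed
      then have "j - n + n = j" by simp
      then have "(f ^^ (j - n)) ((f ^^ n) z) = (f ^^ j) z" for z
        using funpow_add[of "j - n" n f] by (metis comp_apply)
      then show ?thesis using j by (intro exI[of _ "j - n"]) auto
    qed
    have inj: "inj_on (f ^^ n) ?A"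
    proof (rule inj_onI, rule ccontr)
      fix x x' assume "x \<in> ?A" "x' \<in> ?A" "(f ^^ n) x = (f ^^ n) x'" "x \<noteq> x'"
      then show False using far[of x x'] \<eta> by auto
    qed
    have "separated f (r - n) \<eta> ((f ^^ n) ` ?A)"
      unfolding separated_def le_bowen_dist_iff
    proof (intro ballI impI)
      fix a b assume "a \<in> (f ^^ n) ` ?A" "b \<in> (f ^^ n) ` ?A" "a \<noteq> b"
      then obtain x x' where "x \<in> ?A" "x' \<in> ?A" "a = (f ^^ n) x" "b = (f ^^ n) x'" "x \<noteq> x'" by blast
      then show "\<exists>j\<le>r - n. \<eta> \<le> dist ((f ^^ j) a) ((f ^^ j) b)" using far[of x x'] by simp
    qed
    from IH[OF this] show ?thesis unfolding sum.reindex[OF inj] comp_def .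
  qed
  have "(\<Sum>x\<in>E. w x) \<le> (\<Sum>x\<in>E. g (p x) * v ((f ^^ n) x))"
  proof (rule sum_mono)
    fix x assume x: "x \<in> E"
    show "w x \<le> g (p x) * v ((f ^^ n) x)"
      using w[OF x] mult_right_mono[OF p(3)[OF x] v[of "(f ^^ n) x"]] by linarith
  qed
  also have "\<dots> = (\<Sum>q\<in>{..<K} \<times> F. \<Sum>x\<in>{x \<in> E. ?q x = q}. g (p x) * v ((f ^^ n) x))"
    using fin finF p(1) col(1) by (intro sum.group[symmetric]) auto
  also have "\<dots> \<le> (\<Sum>q\<in>{..<K} \<times> F. g (snd q) * C)"
  proof (rule sum_mono)
    fix q assume "q \<in> {..<K} \<times> F"
    obtain i y where q: "q = (i, y)" by (cases q)
    have "(\<Sum>x\<in>{x \<in> E. ?q x = q}. g (p x) * v ((f ^^ n) x)) = g y * (\<Sum>x\<in>{x \<in> E. ?q x = q}. v ((f ^^ n) x))"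
      unfolding sum_distrib_left q by (rule sum.cong) auto
    also have "\<dots> \<le> g y * C" unfolding q using cell g(2) by (rule mult_left_mono)
    finally show "(\<Sum>x\<in>{x \<in> E. ?q x = q}. g (p x) * v ((f ^^ n) x)) \<le> g (snd q) * C" by (simp add: q)
  qed
  also have "\<dots> = (\<Sum>i<K. \<Sum>y\<in>F. g y * C)"
    unfolding sum.cartesian_product by (rule sum.cong) (auto simp: split_beta)
  also have "\<dots> = real K * (\<Sum>y\<in>F. g y) * C"
    by (simp add: sum_distrib_right)
  also have "\<dots> \<le> real K * partition_sum f n (\<eta> / 2) g * C"
    using sum_le_partition_sum[OF \<eta>2 F(2) g(1)] C by (intro mult_right_mono mult_left_mono) auto
  finally show ?thesis .
qed

text \<open>
  The pressure is the supremum over all scales, so it bounds the growth rate at each of them.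
\<close>

lemma eventually_partition_sum_le:
  assumes \<Phi>: "\<Phi> \<in> Sb f" and \<epsilon>: "\<epsilon> > 0" and P: "pressure f \<Phi> < ereal a"
  shows "\<forall>\<^sub>F n in sequentially. partition_sum f n \<epsilon> (\<lambda>x. exp (\<Phi> n x)) \<le> exp (real n * a)"
proof -
  have "pressure_at f \<Phi> \<epsilon> \<le> pressure f \<Phi>"
    using \<epsilon> by (subst pressure_eq_SUP) (auto intro: SUP_upper Sb_continuous[OF \<Phi>])
  then have "pressure_at f \<Phi> \<epsilon> < ereal a" using P by (rule le_less_trans)
  then have "\<forall>\<^sub>F n in sequentially. ereal (ln (partition_sum f n \<epsilon> (\<lambda>x. exp (\<Phi> n x))) / real n) < ereal a"
    unfolding pressure_at_def by (rule Limsup_lessD)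
  then show ?thesis using eventually_ge_at_top[of 1]
  proof eventually_elim
    case (elim n)
    have "0 < partition_sum f n \<epsilon> (\<lambda>x. exp (\<Phi> n x))"
      by (intro partition_sum_exp_pos \<epsilon> Sb_continuous[OF \<Phi>] elim(2))
    moreover have "ln (partition_sum f n \<epsilon> (\<lambda>x. exp (\<Phi> n x))) \<le> real n * a"
      using elim by (simp add: field_simps)
    ultimately show ?case by (metis exp_le_cancel_iff exp_ln)
  qed
qed

lemma pressure_leI:
  assumes \<Phi>: "\<Phi> \<in> Sb f"
    and bd: "\<And>\<epsilon>. \<epsilon> > 0 \<Longrightarrow> \<exists>C>0. \<forall>n\<ge>1. \<forall>E. separated f n \<epsilon> E \<longrightarrow> (\<Sum>x\<in>E. exp (\<Phi> n x - real n * a)) \<le> C"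
  shows "pressure f \<Phi> \<le> ereal a"
proof -
  have "pressure_at f \<Phi> \<epsilon> \<le> ereal a" if \<epsilon>: "\<epsilon> > 0" for \<epsilon>
  proof -
    obtain C where C: "C > 0"
      "\<And>n E. n \<ge> 1 \<Longrightarrow> separated f n \<epsilon> E \<Longrightarrow> (\<Sum>x\<in>E. exp (\<Phi> n x - real n * a)) \<le> C"
      using bd[OF \<epsilon>] by blast
    have "\<forall>\<^sub>F n in sequentially. ereal (ln (partition_sum f n \<epsilon> (\<lambda>x. exp (\<Phi> n x))) / real n)
        \<le> ereal (ln C / real n + a)"
      using eventually_ge_at_top[of 1]
    proof eventually_elim
      case (elim n)
      let ?Z = "partition_sum f n \<epsilon> (\<lambda>x. exp (\<Phi> n x))"
      have "?Z \<le> C * exp (real n * a)"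
      proof (rule partition_sum_le)
        fix E assume E: "separated f n \<epsilon> E"
        have "(\<Sum>x\<in>E. exp (\<Phi> n x)) = (\<Sum>x\<in>E. exp (\<Phi> n x - real n * a)) * exp (real n * a)"
          by (simp add: sum_distrib_right exp_add[symmetric])
        also have "\<dots> \<le> C * exp (real n * a)"
          using C(2)[OF elim E] by (rule mult_right_mono) simp
        finally show "(\<Sum>x\<in>E. exp (\<Phi> n x)) \<le> C * exp (real n * a)" .
      qed
      moreover have "0 < ?Z" by (intro partition_sum_exp_pos \<epsilon> Sb_continuous[OF \<Phi> elim])
      ultimately have "ln ?Z \<le> ln (C * exp (real n * a))" by (intro ln_mono) auto
      also have "\<dots> = ln C + real n * a" using C(1) by (simp add: ln_mult)
      finally have "ln ?Z / real n \<le> (ln C + real n * a) / real n" by (rule divide_right_mono) simp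
      then show ?case using elim by (simp add: add_divide_distrib)
    qed
    then have "pressure_at f \<Phi> \<epsilon> \<le> limsup (\<lambda>n. ereal (ln C / real n + a))"
      unfolding pressure_at_def by (rule Limsup_mono)
    also have "\<dots> = ereal a"
    proof (rule lim_imp_Limsup)
      have "(\<lambda>n. ln C / real n + a) \<longlonglongrightarrow> 0 + a"
        by (intro tendsto_add lim_const_over_n tendsto_const)
      then show "(\<lambda>n. ereal (ln C / real n + a)) \<longlonglongrightarrow> ereal a" by simp
    qed simp
    finally show ?thesis .
  qed
  then show ?thesis by (subst pressure_eq_SUP) (auto intro: SUP_least Sb_continuous[OF \<Phi>])
qed

text \<open>
  If every point starts a block of one of finitely many types \<open>\<tau>\<close>, and the total weight of the types is
  at most 1, the partition sums rescaled by \<open>exp (- r a)\<close> stay bounded: by strong induction on \<open>r\<close>, splitting off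
  the first block bounds the sum for \<open>r\<close> by an average of the bounds for shorter times. Times up to the
  largest block length are absorbed in the constant.
\<close>

lemma renewal_bound:
  fixes len :: "'t \<Rightarrow> nat"
  assumes \<Phi>: "\<Phi> \<in> Sb f" and \<eta>: "\<eta> > 0" and T: "finite T"
    and len: "\<And>\<tau>. \<tau> \<in> T \<Longrightarrow> 1 \<le> len \<tau>"
    and g: "\<And>\<tau>. \<tau> \<in> T \<Longrightarrow> continuous_on UNIV (g \<tau>)" "\<And>\<tau> z. 0 \<le> g \<tau> z"
    and cover: "\<And>x. \<exists>\<tau>\<in>T. exp (\<Phi> (len \<tau>) x - real (len \<tau>) * a) \<le> g \<tau> ((f ^^ shift \<tau>) x)"
    and col: "\<And>k x. col k x < (K k :: nat)"
      "\<And>k x y j. col k x = col k y \<Longrightarrow> j \<le> k \<Longrightarrow> dist ((f ^^ j) x) ((f ^^ j) y) < \<eta>"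
    and small: "(\<Sum>\<tau>\<in>T. real (K (shift \<tau>)) * partition_sum f (len \<tau>) (\<eta> / 2) (g \<tau>)) \<le> 1"
  shows "\<exists>C>0. \<forall>r\<ge>1. \<forall>E. separated f r \<eta> E \<longrightarrow> (\<Sum>x\<in>E. exp (\<Phi> r x - real r * a)) \<le> C"
proof -
  define N where "N = Max (insert 1 (len ` T))"
  have N: "len \<tau> \<le> N" if "\<tau> \<in> T" for \<tau> unfolding N_def using T that by (intro Max_ge) auto
  define Z where "Z r = partition_sum f r \<eta> (\<lambda>x. exp (\<Phi> r x - real r * a))" for r
  have ce: "continuous_on UNIV (\<lambda>x. exp (\<Phi> r x - real r * a))" if "r \<ge> 1" for r
    by (intro continuous_intros Sb_continuous[OF \<Phi> that])
  have ZE: "(\<Sum>x\<in>E. exp (\<Phi> r x - real r * a)) \<le> Z r" if "r \<ge> 1" "separated f r \<eta> E" for r E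
    unfolding Z_def by (rule sum_le_partition_sum[OF \<eta> that(2) ce[OF that(1)]])
  define C where "C = 1 + (\<Sum>r\<in>{1..N}. \<bar>Z r\<bar>)"
  have C0: "C > 0" unfolding C_def by (intro add_pos_nonneg sum_nonneg) auto
  from cover obtain \<tau> where \<tau>: "\<And>x. \<tau> x \<in> T"
    "\<And>x. exp (\<Phi> (len (\<tau> x)) x - real (len (\<tau> x)) * a) \<le> g (\<tau> x) ((f ^^ shift (\<tau> x)) x)"
    by metis
  have "(\<Sum>x\<in>E. exp (\<Phi> r x - real r * a)) \<le> C" if "r \<ge> 1" "separated f r \<eta> E" for r E
    using that
  proof (induction r arbitrary: E rule: less_induct)
    case (less r)
    show ?case
    proof (cases "r \<le> N")
      case True
      have "\<bar>Z r\<bar> \<le> (\<Sum>r\<in>{1..N}. \<bar>Z r\<bar>)" using True less.prems by (intro member_le_sum) auto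
      then show ?thesis using ZE[OF less.prems] unfolding C_def by linarith
    next
      case False
      have piece: "(\<Sum>x\<in>{x \<in> E. \<tau> x = t}. exp (\<Phi> r x - real r * a))
          \<le> real (K (shift t)) * partition_sum f (len t) (\<eta> / 2) (g t) * C" if t: "t \<in> T" for t
      proof (rule sum_over_separated_split[OF \<eta>, where r = r and k = "shift t" and c = "col (shift t)"
            and v = "\<lambda>z. exp (\<Phi> (r - len t) z - real (r - len t) * a)"])
        show lt: "len t < r" using N[OF t] False by simp
        show "separated f r \<eta> {x \<in> E. \<tau> x = t}"
          using less.prems(2) unfolding separated_def by blast
        fix x assume "x \<in> {x \<in> E. \<tau> x = t}"
        then have tx: "\<tau> x = t" by simp
        have "\<Phi> (len t + (r - len t)) x \<le> \<Phi> (len t) x + \<Phi> (r - len t) ((f ^^ len t) x)"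
          using lt len[OF t] by (intro Sb_subadditive[OF \<Phi>]) auto
        moreover have "real (len t) * a + real (r - len t) * a = real r * a"
          using lt by (simp add: of_nat_diff algebra_simps)
        ultimately have "\<Phi> r x - real r * a \<le> (\<Phi> (len t) x - real (len t) * a)
            + (\<Phi> (r - len t) ((f ^^ len t) x) - real (r - len t) * a)"
          using lt by simp
        then have "exp (\<Phi> r x - real r * a) \<le> exp (\<Phi> (len t) x - real (len t) * a)
            * exp (\<Phi> (r - len t) ((f ^^ len t) x) - real (r - len t) * a)"
          by (simp add: exp_add[symmetric])
        also have "\<dots> \<le> g t ((f ^^ shift t) x) * exp (\<Phi> (r - len t) ((f ^^ len t) x) - real (r - len t) * a)"
          using \<tau>(2)[of x] unfolding tx by (rule mult_right_mono) simp
        finally show "exp (\<Phi> r x - real r * a) \<le> \<dots>" .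
      next
        fix E' assume "separated f (r - len t) \<eta> E'"
        then show "(\<Sum>z\<in>E'. exp (\<Phi> (r - len t) z - real (r - len t) * a)) \<le> C"
          using N[OF t] False len[OF t] by (intro less.IH) auto
      qed (use g t C0 col in auto)
      have "finite E" using separated_finite[OF \<eta> less.prems(2)] .
      then have "(\<Sum>x\<in>E. exp (\<Phi> r x - real r * a)) = (\<Sum>t\<in>T. \<Sum>x\<in>{x \<in> E. \<tau> x = t}. exp (\<Phi> r x - real r * a))"
        using T \<tau>(1) by (intro sum.group[symmetric]) auto
      also have "\<dots> \<le> (\<Sum>t\<in>T. real (K (shift t)) * partition_sum f (len t) (\<eta> / 2) (g t) * C)"
        by (intro sum_mono piece)
      also have "\<dots> = (\<Sum>t\<in>T. real (K (shift t)) * partition_sum f (len t) (\<eta> / 2) (g t)) * C"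
        by (simp add: sum_distrib_right)
      also have "\<dots> \<le> 1 * C" using small C0 by (intro mult_right_mono) auto
      finally show ?thesis by simp
    qed
  qed
  then show ?thesis using C0 by blast
qed

text \<open>
  Suppose the contrary and put \<open>d = e/4\<close>. A type is a triple \<open>(k, \<Phi>, n)\<close>, and the open set \<open>W (k, \<Phi>, n)\<close> consists of the
  points \<open>x\<close> for which \<open>\<Phi>0 n x - n (P \<Phi>0 - d) < \<Phi> n (f\<^sup>k x) - n (P \<Phi> + d)\<close>. The margin \<open>e\<close> covers the two shifts of the
  pressures by \<open>d\<close> and the error \<open>e/2\<close> in the choice of \<open>k\<close>.
  The partition sum of the exponential of the right-hand side, multiplied by the number of colours for \<open>k\<close>, is
  eventually at most \<open>\<theta>\<^sup>n\<close> with \<open>\<theta> = exp (- d/2)\<close>, so over the types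
  with \<open>n \<ge> n0\<close> and \<open>k \<le> n\<close> these quantities have a small sum.
\<close>

lemma ex_point_nearly_dominating:
  assumes S: "finite S" "S \<subseteq> Sb f" and \<Phi>0: "\<Phi>0 \<in> Sb f"
    and P: "\<And>\<Phi>. \<Phi> \<in> insert \<Phi>0 S \<Longrightarrow> pressure f \<Phi> = ereal (P \<Phi>)"
    and e: "e > 0"
  shows "\<exists>x. \<forall>\<Phi>\<in>S. P \<Phi>0 - psi \<Phi>0 x - e \<le> P \<Phi> - psi \<Phi> x"
proof (rule ccontr)
  assume "\<not> ?thesis"
  then have H: "\<exists>\<Phi>\<in>S. P \<Phi> - psi \<Phi> x < P \<Phi>0 - psi \<Phi>0 x - e" for x by (force simp: not_le)
  define d where "d = e / 4"
  have d: "d > 0" using e by (simp add: d_def)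
  define \<theta> where "\<theta> = exp (- (d / 2))"
  have \<theta>: "0 < \<theta>" "\<theta> < 1" using d by (auto simp: \<theta>_def)
  have m: "real (card S) > 0" using H S(1) by (auto simp: card_gt_0_iff)
  have "pressure f \<Phi>0 \<le> ereal (P \<Phi>0 - d)"
  proof (rule pressure_leI[OF \<Phi>0])
    fix \<eta> :: real assume \<eta>: "\<eta> > 0"
    have "\<forall>k. \<exists>cK :: ('a \<Rightarrow> nat) \<times> nat. (\<forall>x. fst cK x < snd cK) \<and>
        (\<forall>x y. fst cK x = fst cK y \<longrightarrow> (\<forall>j\<le>k. dist ((f ^^ j) x) ((f ^^ j) y) < \<eta>))"
      using small_coloring[OF \<eta>] by simp
    from choice[OF this] obtain cK :: "nat \<Rightarrow> ('a \<Rightarrow> nat) \<times> nat" where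
      "\<forall>k. (\<forall>x. fst (cK k) x < snd (cK k)) \<and>
        (\<forall>x y. fst (cK k) x = fst (cK k) y \<longrightarrow> (\<forall>j\<le>k. dist ((f ^^ j) x) ((f ^^ j) y) < \<eta>))" ..
    then have col: "\<And>k x. fst (cK k) x < snd (cK k)"
      "\<And>k x y j. fst (cK k) x = fst (cK k) y \<Longrightarrow> j \<le> k \<Longrightarrow> dist ((f ^^ j) x) ((f ^^ j) y) < \<eta>"
      by auto
    define K where "K k = snd (cK k)" for k
    define len where "len \<tau> = snd (snd \<tau>)" for \<tau> :: "nat \<times> (nat \<Rightarrow> 'a \<Rightarrow> real) \<times> nat"
    define shift where "shift \<tau> = fst \<tau>" for \<tau> :: "nat \<times> (nat \<Rightarrow> 'a \<Rightarrow> real) \<times> nat"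
    define pot where "pot \<tau> = fst (snd \<tau>)" for \<tau> :: "nat \<times> (nat \<Rightarrow> 'a \<Rightarrow> real) \<times> nat"
    define g where "g \<tau> z = exp (pot \<tau> (len \<tau>) z - real (len \<tau>) * (P (pot \<tau>) + d))" for \<tau> z
    have "summable (\<lambda>n. real (Suc n) * \<theta> ^ n)"
      using geometric_deriv_sums[of \<theta>] \<theta> by (auto dest: sums_summable)
    then obtain n0 where n0: "\<And>n. norm (\<Sum>i\<in>{n0..<n}. real (Suc i) * \<theta> ^ i) < 1 / real (card S)"
      using m unfolding summable_Cauchy by (meson divide_pos_pos order_refl zero_less_one)
    \<comment> \<open>The condition \<open>shift \<tau> \<le> len \<tau>\<close> leaves at most \<open>Suc n * card S\<close> types of length \<open>n\<close>,
       so that the total weight is a tail of the convergent series of \<open>Suc n * \<theta> ^ n\<close>.\<close>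
    define good where "good \<tau> \<longleftrightarrow> pot \<tau> \<in> S \<and> 1 \<le> len \<tau> \<and> n0 \<le> len \<tau> \<and> shift \<tau> \<le> len \<tau> \<and>
      real (K (shift \<tau>)) * partition_sum f (len \<tau>) (\<eta> / 2) (g \<tau>) \<le> \<theta> ^ len \<tau>" for \<tau>
    have good_ev: "\<forall>\<^sub>F n in sequentially. good (k, \<Phi>, n)" if \<Phi>: "\<Phi> \<in> S" for k \<Phi>
    proof -
      have "\<forall>\<^sub>F n in sequentially. partition_sum f n (\<eta> / 2) (\<lambda>x. exp (\<Phi> n x)) \<le> exp (real n * (P \<Phi> + d / 4))"
        using \<Phi> S(2) \<eta> d P[of \<Phi>] by (intro eventually_partition_sum_le) auto
      moreover have "\<forall>\<^sub>F n in sequentially. real (K k) / (d / 4) \<le> real n"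
        using filterlim_real_sequentially by (simp add: filterlim_at_top)
      ultimately show ?thesis
        using eventually_ge_at_top[of 1] eventually_ge_at_top[of n0] eventually_ge_at_top[of k]
      proof eventually_elim
        case (elim n)
        let ?Z = "partition_sum f n (\<eta> / 2) (\<lambda>x. exp (\<Phi> n x))"
        have "partition_sum f n (\<eta> / 2) (g (k, \<Phi>, n)) \<le> ?Z * exp (- (real n * (P \<Phi> + d)))"
        proof (rule partition_sum_le)
          fix E assume E: "separated f n (\<eta> / 2) E"
          have "(\<Sum>x\<in>E. g (k, \<Phi>, n) x) = (\<Sum>x\<in>E. exp (\<Phi> n x)) * exp (- (real n * (P \<Phi> + d)))"
            by (simp add: g_def pot_def len_def sum_distrib_right exp_add[symmetric])
          also have "\<dots> \<le> ?Z * exp (- (real n * (P \<Phi> + d)))"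
            using E \<eta> Sb_continuous[of \<Phi> f n] S(2) \<Phi> elim(3)
            by (intro mult_right_mono sum_le_partition_sum continuous_on_exp) auto
          finally show "(\<Sum>x\<in>E. g (k, \<Phi>, n) x) \<le> \<dots>" .
        qed
        also have "\<dots> \<le> exp (real n * (P \<Phi> + d / 4)) * exp (- (real n * (P \<Phi> + d)))"
          using elim(1) by (rule mult_right_mono) simp
        finally have g: "partition_sum f n (\<eta> / 2) (g (k, \<Phi>, n)) \<le> \<dots>" .
        have "real (K k) \<le> real n * (d / 4)" using elim(2) d by (simp add: field_simps)
        also have "\<dots> \<le> exp (real n * (d / 4))" using exp_ge_add_one_self[of "real n * (d / 4)"] by linarith
        finally have K: "real (K k) \<le> exp (real n * (d / 4))" .
        have "real (K k) * partition_sum f n (\<eta> / 2) (g (k, \<Phi>, n))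
            \<le> real (K k) * (exp (real n * (P \<Phi> + d / 4)) * exp (- (real n * (P \<Phi> + d))))"
          using g by (rule mult_left_mono) simp
        also have "\<dots> \<le> exp (real n * (d / 4)) * (exp (real n * (P \<Phi> + d / 4)) * exp (- (real n * (P \<Phi> + d))))"
          using K by (rule mult_right_mono) simp
        also have "\<dots> = exp (real n * (- (d / 2)))"
          unfolding exp_add[symmetric] by (rule arg_cong[of _ _ exp]) (simp add: field_simps)
        also have "\<dots> = \<theta> ^ n" unfolding \<theta>_def by (rule exp_of_nat_mult)
        finally show ?case using elim \<Phi> by (simp add: good_def pot_def len_def shift_def)
      qed
    qed
    define W where "W \<tau> = {x. \<Phi>0 (len \<tau>) x - real (len \<tau>) * (P \<Phi>0 - d)
        < pot \<tau> (len \<tau>) ((f ^^ shift \<tau>) x) - real (len \<tau>) * (P (pot \<tau>) + d)}" for \<tau>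
    have openW: "open (W \<tau>)" if "\<tau> \<in> Collect good" for \<tau>
    proof -
      have "pot \<tau> \<in> Sb f" "1 \<le> len \<tau>" using that S(2) by (auto simp: good_def)
      then have c: "continuous_on UNIV (pot \<tau> (len \<tau>))" "continuous_on UNIV (\<Phi>0 (len \<tau>))"
        using Sb_continuous[OF \<Phi>0] Sb_continuous by blast+
      have "continuous_on UNIV (\<lambda>x. pot \<tau> (len \<tau>) ((f ^^ shift \<tau>) x))"
        by (rule continuous_on_compose2[OF c(1) continuous_on_funpow]) simp
      with c(2) show ?thesis unfolding W_def
        by (intro open_Collect_less continuous_on_diff continuous_on_const)
    qed
    have "\<exists>\<tau>. good \<tau> \<and> x \<in> W \<tau>" for x
    proof -
      obtain k where k: "\<And>N. \<exists>n\<ge>N. n \<ge> 1 \<and> \<Phi>0 n x < real n * (psi \<Phi>0 ((f ^^ k) x) + e / 2)"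
        using infinitely_often_near_psi[OF \<Phi>0, of "e / 2" x] e by auto
      obtain \<Phi> where \<Phi>: "\<Phi> \<in> S" "P \<Phi> - psi \<Phi> ((f ^^ k) x) < P \<Phi>0 - psi \<Phi>0 ((f ^^ k) x) - e"
        using H by blast
      obtain N where N: "\<And>n. n \<ge> N \<Longrightarrow> good (k, \<Phi>, n)"
        using good_ev[OF \<Phi>(1)] unfolding eventually_sequentially by blast
      obtain n where n: "n \<ge> N" "n \<ge> 1" "\<Phi>0 n x < real n * (psi \<Phi>0 ((f ^^ k) x) + e / 2)"
        using k by blast
      have "psi \<Phi>0 ((f ^^ k) x) + e / 2 \<le> psi \<Phi> ((f ^^ k) x) + (P \<Phi>0 - d) - (P \<Phi> + d)"
        using \<Phi>(2) by (simp add: d_def)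
      then have "real n * (psi \<Phi>0 ((f ^^ k) x) + e / 2)
          \<le> real n * (psi \<Phi> ((f ^^ k) x) + (P \<Phi>0 - d) - (P \<Phi> + d))"
        by (rule mult_left_mono) simp
      also have "\<dots> = real n * psi \<Phi> ((f ^^ k) x) + real n * (P \<Phi>0 - d) - real n * (P \<Phi> + d)"
        by (simp only: right_diff_distrib distrib_left)
      also have "\<dots> \<le> \<Phi> n ((f ^^ k) x) + real n * (P \<Phi>0 - d) - real n * (P \<Phi> + d)"
        using psi_le[of \<Phi> f n "(f ^^ k) x"] \<Phi>(1) S(2) n(2) by auto
      finally have "x \<in> W (k, \<Phi>, n)"
        using n(3) unfolding W_def by (simp add: pot_def len_def shift_def)
      then show ?thesis using N[OF n(1)] by blast
    qed
    then have cov: "UNIV \<subseteq> (\<Union>\<tau>\<in>Collect good. W \<tau>)" by blast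
    obtain T where T: "T \<subseteq> Collect good" "finite T" "UNIV \<subseteq> (\<Union>\<tau>\<in>T. W \<tau>)"
      by (rule compactE_image[OF compact_space openW cov])
    define M where "M = Suc (Max (insert n0 (len ` T)))"
    have lenM: "len ` T \<subseteq> {n0..<M}"
    proof
      fix n assume n: "n \<in> len ` T"
      then have "n \<le> Max (insert n0 (len ` T))" using T(2) by (intro Max_ge) auto
      moreover have "n0 \<le> n" using n T(1) by (auto simp: good_def)
      ultimately show "n \<in> {n0..<M}" by (simp add: M_def)
    qed
    have "(\<Sum>\<tau>\<in>T. real (K (shift \<tau>)) * partition_sum f (len \<tau>) (\<eta> / 2) (g \<tau>)) \<le> (\<Sum>\<tau>\<in>T. \<theta> ^ len \<tau>)"
      using T(1) by (intro sum_mono) (auto simp: good_def)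
    also have "\<dots> = (\<Sum>n\<in>{n0..<M}. \<Sum>\<tau>\<in>{\<tau> \<in> T. len \<tau> = n}. \<theta> ^ len \<tau>)"
      using T(2) lenM by (intro sum.group[symmetric]) auto
    also have "\<dots> \<le> (\<Sum>n\<in>{n0..<M}. real (card S) * (real (Suc n) * \<theta> ^ n))"
    proof (rule sum_mono)
      fix n
      have "{\<tau> \<in> T. len \<tau> = n} \<subseteq> {..n} \<times> S \<times> {n}"
        using T(1) by (auto simp: good_def pot_def len_def shift_def)
      then have "card {\<tau> \<in> T. len \<tau> = n} \<le> card ({..n} \<times> S \<times> {n})"
        using S(1) by (intro card_mono) auto
      then have "card {\<tau> \<in> T. len \<tau> = n} \<le> Suc n * card S" by (simp add: card_cartesian_product)
      then have "real (card {\<tau> \<in> T. len \<tau> = n}) \<le> real (Suc n * card S)" by (rule of_nat_mono)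
      then have "real (card {\<tau> \<in> T. len \<tau> = n}) * \<theta> ^ n \<le> real (Suc n * card S) * \<theta> ^ n"
        using \<theta>(1) by (intro mult_right_mono) auto
      then show "(\<Sum>\<tau>\<in>{\<tau> \<in> T. len \<tau> = n}. \<theta> ^ len \<tau>) \<le> real (card S) * (real (Suc n) * \<theta> ^ n)"
        by (simp add: algebra_simps)
    qed
    also have "\<dots> = real (card S) * (\<Sum>n\<in>{n0..<M}. real (Suc n) * \<theta> ^ n)"
      by (rule sum_distrib_left[symmetric])
    also have "\<dots> \<le> real (card S) * (1 / real (card S))"
    proof (rule mult_left_mono)
      show "(\<Sum>n\<in>{n0..<M}. real (Suc n) * \<theta> ^ n) \<le> 1 / real (card S)"
        using n0[of M] unfolding real_norm_def by linarith
    qed simp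
    also have "\<dots> = 1" using m by simp
    finally have small: "(\<Sum>\<tau>\<in>T. real (K (shift \<tau>)) * partition_sum f (len \<tau>) (\<eta> / 2) (g \<tau>)) \<le> 1" .
    show "\<exists>C>0. \<forall>n\<ge>1. \<forall>E. separated f n \<eta> E \<longrightarrow> (\<Sum>x\<in>E. exp (\<Phi>0 n x - real n * (P \<Phi>0 - d))) \<le> C"
    proof (rule renewal_bound[OF \<Phi>0 \<eta> T(2), where len = len and g = g and shift = shift
          and col = "\<lambda>k. fst (cK k)" and K = K])
      show "1 \<le> len \<tau>" if "\<tau> \<in> T" for \<tau> using that T(1) by (auto simp: good_def)
      show "continuous_on UNIV (g \<tau>)" if "\<tau> \<in> T" for \<tau>
      proof -
        have "good \<tau>" using that T(1) by blast
        then have "continuous_on UNIV (pot \<tau> (len \<tau>))"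
          using S(2) by (intro Sb_continuous[of "pot \<tau>" f]) (auto simp: good_def)
        then show ?thesis unfolding g_def by (intro continuous_intros)
      qed
      show "0 \<le> g \<tau> z" for \<tau> z by (simp add: g_def)
      show "\<exists>\<tau>\<in>T. exp (\<Phi>0 (len \<tau>) x - real (len \<tau>) * (P \<Phi>0 - d)) \<le> g \<tau> ((f ^^ shift \<tau>) x)" for x
      proof -
        obtain \<tau> where "\<tau> \<in> T" "x \<in> W \<tau>" using T(3) by blast
        then show ?thesis by (intro bexI[of _ \<tau>]) (auto simp: W_def g_def)
      qed
      show "fst (cK k) x < K k" for k x using col(1) by (simp add: K_def)
      show "dist ((f ^^ j) x) ((f ^^ j) y) < \<eta>" if "fst (cK k) x = fst (cK k) y" "j \<le> k" for k x y j
        using col(2) that by blast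
    qed (rule small)
  qed
  then show False using P[of \<Phi>0] d by simp
qed

end

section \<open>The affine entropy map\<close>

context compact_system
begin

text \<open>
  Passing to all functions above a minimum, instead of the minima themselves, makes closure under
  minima a matter of taking the union of the finite sets.
\<close>

definition majorants :: "('a \<Rightarrow> real) set" where
  "majorants = {\<phi> \<in> Bm. \<exists>S. finite S \<and> S \<subseteq> Sb f \<and>
     (\<forall>x. \<exists>\<Phi>\<in>S. real_of_ereal (pressure f \<Phi>) - psi \<Phi> x \<le> \<phi> x)}"

lemma ereal_pressure:
  assumes "topological_entropy f < \<infinity>" "\<Phi> \<in> Sb f"
  shows "pressure f \<Phi> = ereal (real_of_ereal (pressure f \<Phi>))"
  using pressure_finite[OF assms(2,1)] by (simp add: ereal_real)

lemma pressure_minus_psi_majorant: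
  assumes "\<Phi> \<in> Sb f"
  shows "(\<lambda>x. real_of_ereal (pressure f \<Phi>) - psi \<Phi> x) \<in> majorants"
proof -
  have "(\<lambda>x. (- 1) * psi \<Phi> x + real_of_ereal (pressure f \<Phi>)) \<in> Bm"
    by (rule Bm_affine[OF psi_Bm[OF assms]])
  then have "(\<lambda>x. real_of_ereal (pressure f \<Phi>) - psi \<Phi> x) \<in> Bm" by simp
  then show ?thesis unfolding majorants_def using assms by (auto intro!: exI[of _ "{\<Phi>}"])
qed

lemma majorants_min_closed_family:
  assumes h: "topological_entropy f < \<infinity>"
  shows "min_closed_family majorants 0"
proof
  show "majorants \<noteq> {}" using pressure_minus_psi_majorant[OF Sb_zero] by blast
  show "majorants \<subseteq> Bm" by (auto simp: majorants_def)
next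
  fix \<phi> :: "'a \<Rightarrow> real" and x assume "\<phi> \<in> majorants"
  then obtain \<Phi> where \<Phi>: "\<Phi> \<in> Sb f" "real_of_ereal (pressure f \<Phi>) - psi \<Phi> x \<le> \<phi> x"
    unfolding majorants_def by blast
  have "ereal (psi \<Phi> x) \<le> ereal (real_of_ereal (pressure f \<Phi>))"
    using psi_le_pressure[OF \<Phi>(1)] ereal_pressure[OF h \<Phi>(1)] by metis
  then show "0 \<le> \<phi> x" using \<Phi>(2) by simp
next
  fix \<phi> \<psi> assume "\<phi> \<in> majorants" "\<psi> \<in> majorants"
  then obtain S T where S: "\<phi> \<in> Bm" "finite S" "S \<subseteq> Sb f"
      "\<forall>x. \<exists>\<Phi>\<in>S. real_of_ereal (pressure f \<Phi>) - psi \<Phi> x \<le> \<phi> x"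
    and T: "\<psi> \<in> Bm" "finite T" "T \<subseteq> Sb f"
      "\<forall>x. \<exists>\<Phi>\<in>T. real_of_ereal (pressure f \<Phi>) - psi \<Phi> x \<le> \<psi> x"
    unfolding majorants_def by blast
  have "\<exists>\<Phi>\<in>S \<union> T. real_of_ereal (pressure f \<Phi>) - psi \<Phi> x \<le> min (\<phi> x) (\<psi> x)" for x
    using S(4) T(4) unfolding min_def by (metis UnI1 UnI2)
  then show "(\<lambda>x. min (\<phi> x) (\<psi> x)) \<in> majorants"
    unfolding majorants_def using S T Bm_min[OF S(1) T(1)]
    by (intro CollectI conjI exI[of _ "S \<union> T"]) auto
qed

text \<open>
  Finitely many majorants involve only finitely many sequences, and the point that nearly dominates all of
  them lies in all the sets.
\<close>

lemma near_maximum_sets_fip: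
  assumes h: "topological_entropy f < \<infinity>" and \<Phi>: "\<Phi> \<in> Sb f"
    and F: "finite F"
      "F \<subseteq> (\<lambda>(\<phi>, e). {x. real_of_ereal (pressure f \<Phi>) - psi \<Phi> x - e \<le> \<phi> x}) ` (majorants \<times> {0<..})"
  shows "\<Inter>F \<noteq> {}"
proof -
  let ?P = "\<lambda>\<Phi>. real_of_ereal (pressure f \<Phi>)"
  let ?G = "\<lambda>q. {x. ?P \<Phi> - psi \<Phi> x - snd q \<le> fst q x}"
  have "F \<subseteq> ?G ` (majorants \<times> {0<..})" using F(2) by (simp add: case_prod_unfold)
  then obtain Q where Q: "finite Q" "Q \<subseteq> majorants \<times> {0<..}" "F = ?G ` Q"
    using F(1) by (meson finite_subset_image)
  have "\<forall>q\<in>Q. \<exists>S. finite S \<and> S \<subseteq> Sb f \<and> (\<forall>x. \<exists>\<Phi>\<in>S. ?P \<Phi> - psi \<Phi> x \<le> fst q x)"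
  proof
    fix q assume "q \<in> Q"
    then have "fst q \<in> majorants" using Q(2) by auto
    then show "\<exists>S. finite S \<and> S \<subseteq> Sb f \<and> (\<forall>x. \<exists>\<Phi>\<in>S. ?P \<Phi> - psi \<Phi> x \<le> fst q x)"
      unfolding majorants_def by (elim CollectE conjE)
  qed
  from bchoice[OF this] obtain S where
    S: "\<forall>q\<in>Q. finite (S q) \<and> S q \<subseteq> Sb f \<and> (\<forall>x. \<exists>\<Phi>\<in>S q. ?P \<Phi> - psi \<Phi> x \<le> fst q x)" ..
  define e where "e = Min (insert 1 (snd ` Q))"
  have e: "e > 0" unfolding e_def using Q(1,2) by (subst Min_gr_iff) auto
  have eq: "e \<le> snd q" if "q \<in> Q" for q unfolding e_def using Q(1) that by (intro Min_le) auto
  have "finite (\<Union>q\<in>Q. S q)" "(\<Union>q\<in>Q. S q) \<subseteq> Sb f" using Q(1) S by auto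
  from ex_point_nearly_dominating[OF this \<Phi> _ e, of ?P] obtain x
    where x: "\<forall>\<Psi>\<in>(\<Union>q\<in>Q. S q). ?P \<Phi> - psi \<Phi> x - e \<le> ?P \<Psi> - psi \<Psi> x"
    using ereal_pressure[OF h] \<Phi> S by blast
  have "x \<in> ?G q" if q: "q \<in> Q" for q
  proof -
    obtain \<Psi> where \<Psi>: "\<Psi> \<in> S q" "?P \<Psi> - psi \<Psi> x \<le> fst q x" using S q by blast
    then have "?P \<Phi> - psi \<Phi> x - e \<le> ?P \<Psi> - psi \<Psi> x" using x q by blast
    then show ?thesis using \<Psi>(2) eq[OF q] by simp
  qed
  then have "x \<in> \<Inter>F" unfolding Q(3) by (rule INT_I)
  then show ?thesis by (metis empty_iff)
qed

end


theorem theorem8p6: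
  fixes f :: "'a::metric_space \<Rightarrow> 'a"
  assumes "compact (UNIV :: 'a set)"
    and "continuous_on UNIV f"
    and "\<bar>topological_entropy f\<bar> \<noteq> \<infinity>"
  shows "\<exists>h1 :: ('a set \<Rightarrow> real) \<Rightarrow> real.
           affine_on_Pa h1 \<and> usc_on_Pa h1 \<and>
           (\<forall>\<Phi>\<in>Sb f.
              (\<exists>\<mu>\<in>Pa. pressure f \<Phi> = ereal (h1 \<mu> + fa_integral \<mu> (psi \<Phi>))) \<and>
              (\<forall>\<mu>\<in>Pa. ereal (h1 \<mu> + fa_integral \<mu> (psi \<Phi>)) \<le> pressure f \<Phi>))"
proof -
  interpret compact_system f using assms(1,2) by unfold_locales
  have h: "topological_entropy f < \<infinity>" using assms(3) by auto
  interpret min_closed_family majorants 0 by (rule majorants_min_closed_family[OF h])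
  let ?h = "lower_envelope majorants"
  let ?P = "\<lambda>\<Phi>. real_of_ereal (pressure f \<Phi>)"
  have int: "fa_integral \<mu> (\<lambda>x. ?P \<Phi> - psi \<Phi> x - e) = ?P \<Phi> - fa_integral \<mu> (psi \<Phi>) - e"
    if "\<mu> \<in> Pa" "\<Phi> \<in> Sb f" for \<mu> \<Phi> e
    using fa_integral_affine[OF that(1) psi_Bm[OF that(2)], of "- 1" "?P \<Phi> - e"] by (simp add: algebra_simps)
  have le: "?h \<mu> + fa_integral \<mu> (psi \<Phi>) \<le> ?P \<Phi>" if "\<mu> \<in> Pa" "\<Phi> \<in> Sb f" for \<mu> \<Phi>
    using lower_envelope_le[OF that(1) pressure_minus_psi_majorant[OF that(2)]] int[OF that, of 0] by simp
  have ex: "\<exists>\<mu>\<in>Pa. ?P \<Phi> \<le> ?h \<mu> + fa_integral \<mu> (psi \<Phi>)" if \<Phi>: "\<Phi> \<in> Sb f" for \<Phi>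
  proof -
    \<comment> \<open>The maximizing measure gives mass 1 to all sets on which a majorant is at least, up to \<open>e\<close>,
       \<open>P(f,\<Phi>) - \<psi>\<^sub>\<Phi>\<close>, the member of the family that belongs to \<open>\<Phi>\<close> itself.\<close>
    let ?G = "\<lambda>(\<phi>, e). {x. ?P \<Phi> - psi \<Phi> x - e \<le> \<phi> x}"
    obtain \<mu> where \<mu>: "\<mu> \<in> Pa"
      and full: "\<And>B. B \<in> ?G ` (majorants \<times> {0<..}) \<Longrightarrow> B \<in> sets borel \<Longrightarrow> \<mu> B = 1"
      using ex_two_valued_Pa[OF near_maximum_sets_fip[OF h \<Phi>]] by blast
    have "?P \<Phi> - fa_integral \<mu> (psi \<Phi>) \<le> ?h \<mu>"
    proof (rule lower_envelope_greatest)
      fix \<phi> assume \<phi>: "\<phi> \<in> majorants"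
      show "?P \<Phi> - fa_integral \<mu> (psi \<Phi>) \<le> fa_integral \<mu> \<phi>"
      proof (rule field_le_epsilon)
        fix e :: real assume e: "e > 0"
        have B: "\<phi> \<in> Bm" "(\<lambda>x. ?P \<Phi> - psi \<Phi> x - e) \<in> Bm"
          using Bm \<phi> Bm_affine[OF psi_Bm[OF \<Phi>], of "- 1" "?P \<Phi> - e"] by (auto simp: algebra_simps)
        have m: "\<phi> \<in> borel_measurable borel" "psi \<Phi> \<in> borel_measurable borel"
          using B(1) psi_Bm[OF \<Phi>] by (auto simp: Bm_def)
        have "{x \<in> space borel. ?P \<Phi> - psi \<Phi> x - e \<le> \<phi> x} \<in> sets borel"
          using m by measurable
        then have G: "?G (\<phi>, e) \<in> sets borel" by simp
        have "fa_integral \<mu> (\<lambda>x. ?P \<Phi> - psi \<Phi> x - e) \<le> fa_integral \<mu> \<phi>"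
        proof (rule fa_integral_mono_ae[OF \<mu> B(2,1) G])
          show "\<mu> (?G (\<phi>, e)) = 1" using \<phi> e by (intro full[OF _ G] imageI) simp
        qed simp
        then show "?P \<Phi> - fa_integral \<mu> (psi \<Phi>) \<le> fa_integral \<mu> \<phi> + e"
          unfolding int[OF \<mu> \<Phi>] by simp
      qed
    qed
    then show ?thesis using \<mu> by (intro bexI[of _ \<mu>]) auto
  qed
  show ?thesis
  proof (intro exI[of _ ?h] conjI ballI lower_envelope_affine lower_envelope_usc)
    fix \<Phi> assume \<Phi>: "\<Phi> \<in> Sb f"
    obtain \<mu> where "\<mu> \<in> Pa" "?P \<Phi> \<le> ?h \<mu> + fa_integral \<mu> (psi \<Phi>)" using ex[OF \<Phi>] by blast
    then have "\<mu> \<in> Pa" "?h \<mu> + fa_integral \<mu> (psi \<Phi>) = ?P \<Phi>" using le[OF _ \<Phi>] by (auto intro: antisym)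
    then show "\<exists>\<mu>\<in>Pa. pressure f \<Phi> = ereal (?h \<mu> + fa_integral \<mu> (psi \<Phi>))"
      using ereal_pressure[OF h \<Phi>] by metis
    fix \<mu> :: "'a set \<Rightarrow> real" assume "\<mu> \<in> Pa"
    then have "ereal (?h \<mu> + fa_integral \<mu> (psi \<Phi>)) \<le> ereal (?P \<Phi>)" using le[OF _ \<Phi>] by simp
    then show "ereal (?h \<mu> + fa_integral \<mu> (psi \<Phi>)) \<le> pressure f \<Phi>"
      using ereal_pressure[OF h \<Phi>] by metis
  qed
qed

end
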